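(* Fix an integer $k\ge 3$ and suppose there are constants $c>1$ and $d>0$ such that $\mathrm{ex}(x,2k)\le d\,x^{c}$ for all positive integers $x$. Then there is a constant $C$ (depending only on $k,c,d$) such that for every \textsc{Metric TSP} instance $I$ on $n$ vertices with $\mathrm{OPT}(I)>0$ and every $k$-optimal tour $T$ of $I$, $$c(T)\le C\, n^{1-\frac1c}\,\mathrm{OPT}(I).$$ In particular, the approximation ratio $\alpha_k(n)$ of the $k$-Opt algorithm for \textsc{Metric TSP} is $O(n^{1-1/c})$.
   Context: A \textsc{Metric TSP} instance on $n$ vertices is the complete graph $K_n$ with edge costs $c:E(K_n)\to\mathbb{R}_{\ge0}$ satisfying the triangle inequality $c(\{x,z\})+c(\{z,y\})\ge c(\{x,y\})$. A tour is a Hamiltonian cycle; its length is $c(T)=\sum_{e\in T}c(e)$, and $\mathrm{OPT}(I)$ denotes the minimum length of a tour. A $k$-move replaces at most $k$ edges of a tour by other edges so that the result is again a tour; it is improving if the new tour is strictly shorter. A tour is $k$-optimal if no improving $k$-move exists. The $k$-Opt algorithm starts from an arbitrary tour and repeatedly performs improving $k$-moves until the tour is $k$-optimal; hence its possible outputs are exactly the $k$-optimal tours. The approximation ratio $\alpha_k(n)$ of $k$-Opt for \textsc{Metric TSP} is the supremum of $c(T)/\mathrm{OPT}(I)$ over all \textsc{Metric TSP} instances $I$ on $n$ vertices with $\mathrm{OPT}(I)>0$ and all $k$-optimal tours $T$ of $I$. The girth of a graph is the length of its shortest cycle ($\infty$ if it has none). $\mathrm{ex}(n,2k)$ denotes the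 maximum number of edges of a simple graph on $n$ vertices with girth at least $2k$. *)

theory Defs
  imports Complex_Main "HOL-Library.Extended_Nat"
begin

definition metric_instance :: "nat \<Rightarrow> (nat set \<Rightarrow> real) \<Rightarrow> bool" where
  "metric_instance n w \<longleftrightarrow>
     (\<forall>x<n. \<forall>y<n. x \<noteq> y \<longrightarrow> 0 \<le> w {x, y}) \<and>
     (\<forall>x<n. \<forall>y<n. \<forall>z<n. x \<noteq> y \<and> y \<noteq> z \<and> x \<noteq> z \<longrightarrow>
        w {x, y} \<le> w {x, z} + w {z, y})"

definition is_tour :: "nat \<Rightarrow> nat set set \<Rightarrow> bool" where
  "is_tour n T \<longleftrightarrow> 3 \<le> n \<and>
     (\<exists>vs. distinct vs \<and> set vs = {..<n} \<and>
        T = {{vs ! i, vs ! (Suc i mod n)} | i. i < n})"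

definition tour_cost :: "(nat set \<Rightarrow> real) \<Rightarrow> nat set set \<Rightarrow> real" where
  "tour_cost w T = (\<Sum>e\<in>T. w e)"

definition OPT :: "nat \<Rightarrow> (nat set \<Rightarrow> real) \<Rightarrow> real" where
  "OPT n w = Min {tour_cost w T | T. is_tour n T}"

definition k_move :: "nat \<Rightarrow> nat \<Rightarrow> nat set set \<Rightarrow> nat set set \<Rightarrow> bool" where
  "k_move k n T T' \<longleftrightarrow> is_tour n T \<and> is_tour n T' \<and> card (T - T') \<le> k"

definition k_optimal :: "nat \<Rightarrow> nat \<Rightarrow> (nat set \<Rightarrow> real) \<Rightarrow> nat set set \<Rightarrow> bool" where
  "k_optimal k n w T \<longleftrightarrow> is_tour n T \<and>
     \<not> (\<exists>T'. k_move k n T T' \<and> tour_cost w T' < tour_cost w T)"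

definition simple_graph :: "nat \<Rightarrow> nat set set \<Rightarrow> bool" where
  "simple_graph x E \<longleftrightarrow> E \<subseteq> {e. e \<subseteq> {..<x} \<and> card e = 2}"

definition has_cycle :: "nat set set \<Rightarrow> nat \<Rightarrow> bool" where
  "has_cycle E m \<longleftrightarrow> 3 \<le> m \<and>
     (\<exists>vs. length vs = m \<and> distinct vs \<and> (\<forall>i<m. {vs ! i, vs ! (Suc i mod m)} \<in> E))"

definition girth :: "nat set set \<Rightarrow> enat" where
  "girth E = (INF m \<in> {m. has_cycle E m}. enat m)"

definition ex :: "nat \<Rightarrow> nat \<Rightarrow> nat" where
  "ex x g = Max {card E | E. simple_graph x E \<and> enat g \<le> girth E}"

end

theory Submission
  imports Defs "HOL-Library.Multiset"
begin

text \<open>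
  Fix \<open>L\<close> and a small \<open>eps\<close> depending on \<open>k\<close>, and cut an optimal tour into \<open>O(OPT / L)\<close> clusters of
  diameter at most \<open>eps * L\<close>. The edges of the \<open>k\<close>-optimal tour \<open>T\<close> with length in
  \<open>(L, (1 + eps) * L]\<close> form a directed graph on the clusters, and a quarter of them cross a directed
  cut. If the crossing edges contained a cycle of length \<open>2 * h < 2 * k\<close> (a pair of parallel edges
  counting as \<open>h = 1\<close>), its edges would alternate in direction with respect to \<open>T\<close>. Removing all of
  them and joining consecutive ends yields cyclic tours on at most \<open>h\<close> components, since each of these
  contains at least two of the \<open>2 * h\<close> tails. Then \<open>h - 1\<close> of the edges can be put back one at a time, so
  that each step merges two components or, once a single tour is left, keeps it connected by reversing
  a part of it. The result is a tour without \<open>h + 1 \<le> k\<close> of the edges, which is shorter than \<open>T\<close> by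
  nearly \<open>2 * L\<close>. Hence the crossing edges form a graph of girth at least \<open>2 * k\<close>, and there are
  \<open>O((OPT / L) powr c)\<close> edges of length about \<open>L\<close>. Summing over geometrically growing \<open>L\<close>,
  starting at \<open>OPT * n powr (- 1 / c)\<close>, gives the bound.
\<close>

section \<open>Cyclic lists\<close>

text \<open>Multisets account for degenerate cycles: a one-element list contributes a loop, and a
  two-element list contributes the same undirected edge twice. \<open>cyc_edges_switch\<close> can
  produce lists of either length.\<close>

definition cyc_pairs :: "'a list \<Rightarrow> ('a \<times> 'a) multiset" where
  "cyc_pairs xs = mset (zip xs (rotate1 xs))"

definition path_pairs :: "'a list \<Rightarrow> ('a \<times> 'a) multiset" where
  "path_pairs xs = mset (zip xs (tl xs))"

lemma zip_snoc_shift: "zip (x # t) (t @ [y]) = zip (x # t) t @ [(last (x # t), y)]"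
  by (induction t arbitrary: x) auto

lemma cyc_pairs_path_pairs:
  "xs \<noteq> [] \<Longrightarrow> cyc_pairs xs = add_mset (last xs, hd xs) (path_pairs xs)"
  by (cases xs) (simp_all only: cyc_pairs_def path_pairs_def rotate1.simps zip_snoc_shift, simp_all)

lemma path_pairs_append:
  assumes "xs \<noteq> []" "ys \<noteq> []"
  shows "path_pairs (xs @ ys) = add_mset (last xs, hd ys) (path_pairs xs + path_pairs ys)"
  using assms(1)
proof (induction xs rule: list_nonempty_induct)
  case (single x)
  then show ?case using assms(2) by (cases ys) (auto simp: path_pairs_def)
next
  case (cons x xs)
  then show ?case by (cases xs) (auto simp: path_pairs_def)
qed

lemma path_pairs_rev: "path_pairs (rev xs) = image_mset prod.swap (path_pairs xs)"
proof (induction xs)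
  case Nil
  then show ?case by (simp add: path_pairs_def)
next
  case (Cons x xs)
  show ?case
  proof (cases "xs = []")
    case True
    then show ?thesis by (simp add: path_pairs_def)
  next
    case False
    then have "path_pairs (x # xs) = add_mset (x, hd xs) (path_pairs xs)"
      by (cases xs) (auto simp: path_pairs_def)
    moreover have "path_pairs (rev xs @ [x]) = add_mset (hd xs, x) (path_pairs (rev xs))"
      using False path_pairs_append[of "rev xs" "[x]"] by (simp add: last_rev path_pairs_def)
    ultimately show ?thesis using Cons by simp
  qed
qed

lemma cyc_pairs_append:
  assumes "xs \<noteq> []" "ys \<noteq> []"
  shows "cyc_pairs (xs @ ys) =
    path_pairs xs + path_pairs ys + {#(last xs, hd ys), (last ys, hd xs)#}"
  using assms by (simp add: cyc_pairs_path_pairs path_pairs_append)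

lemma cyc_pairs_append_commute: "cyc_pairs (xs @ ys) = cyc_pairs (ys @ xs)"
  by (cases "xs = []"; cases "ys = []") (simp_all add: cyc_pairs_append add_ac)

lemma path_pairs_split:
  assumes "(a, b) \<in># path_pairs xs"
  obtains X Y where "xs = X @ Y" "X \<noteq> []" "Y \<noteq> []" "last X = a" "hd Y = b"
proof -
  have "(a, b) \<in> set (zip xs (tl xs))" using assms by (simp add: path_pairs_def)
  then obtain i where i: "i < length (tl xs)" "xs ! i = a" "tl xs ! i = b"
    by (auto simp: set_zip)
  show ?thesis
  proof (rule that[of "take (Suc i) xs" "drop (Suc i) xs"])
    show "hd (drop (Suc i) xs) = b" using i by (simp add: hd_drop_conv_nth nth_tl)
    show "last (take (Suc i) xs) = a" using i by (simp add: take_Suc_conv_app_nth)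
  qed (use i in auto)
qed

text \<open>A rotation turns the chosen pair into the closing one, so removing it leaves the path
  that \<open>zs\<close> spells from \<open>b\<close> to \<open>a\<close>.\<close>

lemma cyc_pairs_rotate_to:
  assumes "(a, b) \<in># cyc_pairs xs"
  obtains zs where "zs \<noteq> []" "mset zs = mset xs" "cyc_pairs zs = cyc_pairs xs" "last zs = a" "hd zs = b"
proof -
  have ne: "xs \<noteq> []" using assms by (auto simp: cyc_pairs_def)
  then consider "(a, b) = (last xs, hd xs)" | "(a, b) \<in># path_pairs xs"
    using assms by (auto simp: cyc_pairs_path_pairs)
  then show ?thesis
  proof cases
    case 1
    then show ?thesis using that[of xs] ne by simp
  next
    case 2
    then obtain X Y where XY: "xs = X @ Y" "X \<noteq> []" "Y \<noteq> []" "last X = a" "hd Y = b"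
      by (rule path_pairs_split)
    show ?thesis by (rule that[of "Y @ X"]) (use XY in \<open>auto simp: cyc_pairs_append_commute add_ac\<close>)
  qed
qed

lemma cyc_pairs_mem_set: "(a, b) \<in># cyc_pairs xs \<Longrightarrow> a \<in> set xs \<and> b \<in> set xs"
  by (auto simp: cyc_pairs_def dest: set_zip_leftD set_zip_rightD)

lemma cyc_pairs_nth:
  "(a, b) \<in># cyc_pairs xs \<longleftrightarrow> (\<exists>i<length xs. a = xs ! i \<and> b = xs ! (Suc i mod length xs))"
  by (auto simp: cyc_pairs_def set_zip nth_rotate1)

lemma image_fst_cyc_pairs: "image_mset fst (cyc_pairs xs) = mset xs"
  by (simp add: cyc_pairs_def flip: mset_map)

lemma image_snd_cyc_pairs: "image_mset snd (cyc_pairs xs) = mset xs"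
  by (cases xs) (simp_all add: cyc_pairs_def flip: mset_map)

lemma cyc_pairs_ex_succ: "x \<in> set xs \<Longrightarrow> \<exists>y. (x, y) \<in># cyc_pairs xs"
  by (metis cyc_pairs_nth in_set_conv_nth)

lemma cyc_pairs_ex_pred: "y \<in> set xs \<Longrightarrow> \<exists>x. (x, y) \<in># cyc_pairs xs"
  using image_snd_cyc_pairs[of xs] by (metis (no_types, lifting) imageE set_image_mset set_mset_mset surjective_pairing)

lemma cyc_pairs_functional:
  assumes "distinct xs" "(x, y) \<in># cyc_pairs xs" "(x, z) \<in># cyc_pairs xs"
  shows "y = z"
  using assms by (auto simp: cyc_pairs_nth nth_eq_iff_index_eq)

lemma cyc_pairs_injective:
  assumes "distinct xs" "(x, z) \<in># cyc_pairs xs" "(y, z) \<in># cyc_pairs xs"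
  shows "x = y"
proof -
  have "distinct (rotate1 xs)" using assms(1) by simp
  then show ?thesis using assms(2,3)
    by (auto simp: cyc_pairs_def set_zip nth_eq_iff_index_eq)
qed

text \<open>On at least three positions the cyclic successor has neither fixed points nor cycles of
  length two.\<close>

lemma cyc_pairs_asym:
  assumes "distinct xs" "3 \<le> length xs" "(x, y) \<in># cyc_pairs xs"
  shows "(y, x) \<notin># cyc_pairs xs" "x \<noteq> y"
proof -
  obtain i where i: "i < length xs" "x = xs ! i" "y = xs ! (Suc i mod length xs)"
    using assms(3) by (auto simp: cyc_pairs_nth)
  have "Suc i mod length xs \<noteq> i"
    using i assms(2) by (cases "Suc i = length xs") auto
  then show "x \<noteq> y" using i assms(1)
    by (metis length_pos_if_in_set mod_less_divisor nth_eq_iff_index_eq nth_mem)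
  show "(y, x) \<notin># cyc_pairs xs"
  proof
    assume "(y, x) \<in># cyc_pairs xs"
    then obtain j where j: "j < length xs" "y = xs ! j" "x = xs ! (Suc j mod length xs)"
      by (auto simp: cyc_pairs_nth)
    have pos: "Suc i mod length xs < length xs" "Suc j mod length xs < length xs"
      using assms(2) by (auto intro: mod_less_divisor)
    have "j = Suc i mod length xs" "i = Suc j mod length xs"
      using i j pos assms(1) by (metis nth_eq_iff_index_eq)+
    moreover have "Suc m mod length xs = (if Suc m = length xs then 0 else Suc m)" if "m < length xs" for m
      using that by auto
    ultimately have "j = (if Suc i = length xs then 0 else Suc i)" "i = (if Suc j = length xs then 0 else Suc j)"
      using i(1) j(1) by metis+
    then have "j = 0 \<and> Suc i = length xs \<or> j = Suc i" "i = 0 \<and> Suc j = length xs \<or> i = Suc j"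
      by metis+
    then show False using assms(2) by linarith
  qed
qed

text \<open>Iterating the successor from \<open>x\<close> reaches every position. Later proofs use
  this to carry a property around a tour or around a closed walk.\<close>

lemma cyc_pairs_closed:
  assumes "x \<in> set xs" "x \<in> C" and step: "\<And>a b. (a, b) \<in># cyc_pairs xs \<Longrightarrow> a \<in> C \<Longrightarrow> b \<in> C"
  shows "set xs \<subseteq> C"
proof -
  obtain i where i: "i < length xs" "x = xs ! i" using assms(1) by (metis in_set_conv_nth)
  have *: "xs ! ((i + j) mod length xs) \<in> C" for j
  proof (induction j)
    case 0
    then show ?case using i assms(2) by simp
  next
    case (Suc j)
    have "(i + j) mod length xs < length xs" using i by (intro mod_less_divisor) auto
    then have "(xs ! ((i + j) mod length xs), xs ! (Suc ((i + j) mod length xs) mod length xs)) \<in># cyc_pairs xs"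
      unfolding cyc_pairs_nth by blast
    from step[OF this Suc] show ?case by (simp add: mod_Suc_eq)
  qed
  show ?thesis
  proof
    fix y assume "y \<in> set xs"
    then obtain j where j: "j < length xs" "y = xs ! j" by (metis in_set_conv_nth)
    have "(i + (length xs - i + j)) mod length xs = j" using i j by simp
    then show "y \<in> C" using *[of "length xs - i + j"] j by simp
  qed
qed

section \<open>Undirected edges and the switching of two edges\<close>

definition cyc_edges :: "'a list \<Rightarrow> 'a set multiset" where
  "cyc_edges xs = image_mset (\<lambda>(x, y). {x, y}) (cyc_pairs xs)"

definition path_edges :: "'a list \<Rightarrow> 'a set multiset" where
  "path_edges xs = image_mset (\<lambda>(x, y). {x, y}) (path_pairs xs)"

lemma path_edges_rev: "path_edges (rev xs) = path_edges xs"
  unfolding path_edges_def path_pairs_rev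
  by (simp add: multiset.map_comp comp_def case_prod_unfold insert_commute)

lemma cyc_edges_path: "xs \<noteq> [] \<Longrightarrow> cyc_edges xs = add_mset {last xs, hd xs} (path_edges xs)"
  by (simp add: cyc_edges_def path_edges_def cyc_pairs_path_pairs)

lemma cyc_edges_append:
  assumes "xs \<noteq> []" "ys \<noteq> []"
  shows "cyc_edges (xs @ ys) = path_edges xs + path_edges ys + {#{last xs, hd ys}, {last ys, hd xs}#}"
  using assms by (simp add: cyc_edges_def path_edges_def cyc_pairs_append)

lemma path_edges_append:
  assumes "xs \<noteq> []" "ys \<noteq> []"
  shows "path_edges (xs @ ys) = path_edges xs + path_edges ys + {#{last xs, hd ys}#}"
  using assms by (simp add: path_edges_def path_pairs_append)

lemma cyc_edges_rev: "cyc_edges (rev xs) = cyc_edges xs"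
  by (cases "xs = []") (simp_all add: cyc_edges_path path_edges_rev hd_rev last_rev insert_commute)

lemma cyc_edges_mem: "{a, b} \<in># cyc_edges xs \<longleftrightarrow> (a, b) \<in># cyc_pairs xs \<or> (b, a) \<in># cyc_pairs xs"
  unfolding cyc_edges_def by (force simp: doubleton_eq_iff)

lemma cyc_edges_mem_set:
  assumes "{a, b} \<in># cyc_edges xs"
  shows "a \<in> set xs \<and> b \<in> set xs"
  using assms unfolding cyc_edges_mem by (auto dest: cyc_pairs_mem_set)

lemma cyc_edges_rotate_to:
  assumes "{a, b} \<in># cyc_edges xs"
  obtains zs where "zs \<noteq> []" "mset zs = mset xs" "cyc_edges zs = cyc_edges xs" "last zs = a" "hd zs = b"
proof -
  consider "(a, b) \<in># cyc_pairs xs" | "(b, a) \<in># cyc_pairs xs"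
    using assms by (auto simp: cyc_edges_mem)
  then show ?thesis
  proof cases
    case 1
    then obtain zs where "zs \<noteq> []" "mset zs = mset xs" "cyc_pairs zs = cyc_pairs xs" "last zs = a" "hd zs = b"
      by (rule cyc_pairs_rotate_to)
    then show ?thesis using that by (simp add: cyc_edges_def)
  next
    case 2
    then obtain zs where "zs \<noteq> []" "mset zs = mset xs" "cyc_pairs zs = cyc_pairs xs" "last zs = b" "hd zs = a"
      by (rule cyc_pairs_rotate_to)
    then show ?thesis using that[of "rev zs"] cyc_edges_rev[of zs]
      by (simp add: cyc_edges_def last_rev hd_rev)
  qed
qed

text \<open>This is the usual 2-opt move: cut at both edges and reverse one of the two paths. The
  equal direction of the two edges is what keeps the result a single cycle.\<close>

lemma cyc_edges_reverse_switch:
  assumes "(a, b) \<in># cyc_pairs xs" "(c, d) \<in># cyc_pairs xs" "(a, b) \<noteq> (c, d)"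
  shows "\<exists>zs. mset zs = mset xs \<and> cyc_edges zs + {#{a, b}, {c, d}#} = cyc_edges xs + {#{a, c}, {b, d}#}"
proof -
  obtain zs where zs: "zs \<noteq> []" "mset zs = mset xs" "cyc_pairs zs = cyc_pairs xs" "last zs = a" "hd zs = b"
    using assms(1) by (rule cyc_pairs_rotate_to)
  then have "(c, d) \<in># path_pairs zs"
    using assms(2,3) by (metis cyc_pairs_path_pairs insert_iff set_mset_add_mset_insert)
  then obtain X Y where XY: "zs = X @ Y" "X \<noteq> []" "Y \<noteq> []" "last X = c" "hd Y = d"
    by (rule path_pairs_split)
  have 1: "cyc_edges xs = path_edges X + path_edges Y + {#{c, d}, {a, b}#}"
    using XY zs cyc_edges_append[of X Y] by (simp add: cyc_edges_def)
  have 2: "cyc_edges (X @ rev Y) = path_edges X + path_edges Y + {#{a, c}, {b, d}#}"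
    using XY zs cyc_edges_append[of X "rev Y"]
    by (simp add: path_edges_rev last_rev hd_rev insert_commute)
  show ?thesis
    by (rule exI[of _ "X @ rev Y"]) (use 1 2 XY zs(2) in auto)
qed

text \<open>The direction of traversal decides the outcome: if both edges are traversed the same
  way, reversing a path gives one cycle, and otherwise the list splits into two. Hence the result is
  a multiset \<open>F\<close> of lists.\<close>

lemma cyc_edges_switch:
  assumes "{#{a, b}, {c, d}#} \<subseteq># cyc_edges xs"
  shows "\<exists>F. [] \<notin># F \<and> (\<Sum>ws\<in>#F. mset ws) = mset xs \<and>
     (\<Sum>ws\<in>#F. cyc_edges ws) + {#{a, b}, {c, d}#} = cyc_edges xs + {#{a, c}, {b, d}#}"
proof -
  have "{a, b} \<in># cyc_edges xs" using assms by (meson insert_subset_eq_iff)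
  then obtain zs where zs: "zs \<noteq> []" "mset zs = mset xs" "cyc_edges zs = cyc_edges xs" "last zs = a" "hd zs = b"
    by (rule cyc_edges_rotate_to)
  \<comment> \<open>If the two edges coincide, the sub-multiset hypothesis guarantees a second copy
    besides the closing edge.\<close>
  have "{c, d} \<in># path_edges zs"
    using assms zs(1,4,5) unfolding zs(3)[symmetric] by (simp add: cyc_edges_path)
  then consider "(c, d) \<in># path_pairs zs" | "(d, c) \<in># path_pairs zs"
    unfolding path_edges_def by (force simp: doubleton_eq_iff)
  then show ?thesis
  proof cases
    case 1
    then obtain X Y where XY: "zs = X @ Y" "X \<noteq> []" "Y \<noteq> []" "last X = c" "hd Y = d"
      by (rule path_pairs_split)
    have 1: "cyc_edges xs = path_edges X + path_edges Y + {#{c, d}, {a, b}#}"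
      using XY zs(1,4,5) cyc_edges_append[of X Y] unfolding zs(3)[symmetric] by simp
    have 2: "cyc_edges (X @ rev Y) = path_edges X + path_edges Y + {#{a, c}, {b, d}#}"
      using XY zs cyc_edges_append[of X "rev Y"]
      by (simp add: path_edges_rev last_rev hd_rev insert_commute)
    show ?thesis
      by (rule exI[of _ "{#X @ rev Y#}"]) (use 1 2 XY zs(2) in auto)
  next
    case 2
    then obtain X Y where XY: "zs = X @ Y" "X \<noteq> []" "Y \<noteq> []" "last X = d" "hd Y = c"
      by (rule path_pairs_split)
    have 1: "cyc_edges xs = path_edges X + path_edges Y + {#{c, d}, {a, b}#}"
      using XY zs(1,4,5) cyc_edges_append[of X Y] unfolding zs(3)[symmetric]
      by (simp add: insert_commute)
    have 2: "cyc_edges X = add_mset {b, d} (path_edges X)" "cyc_edges Y = add_mset {a, c} (path_edges Y)"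
      using XY zs by (auto simp: cyc_edges_path insert_commute)
    show ?thesis
      by (rule exI[of _ "{#X, Y#}"]) (use 1 2 XY zs(2) in auto)
  qed
qed

text \<open>Both cycles are opened at the chosen edges, giving paths from \<open>b\<close> to
  \<open>a\<close> and from \<open>c\<close> to \<open>d\<close>, whose concatenation closes up with
  the two new edges.\<close>

lemma cyc_edges_merge:
  assumes "{a, b} \<in># cyc_edges xs" "{c, d} \<in># cyc_edges ys"
  shows "\<exists>zs. zs \<noteq> [] \<and> mset zs = mset xs + mset ys \<and>
     cyc_edges zs + {#{a, b}, {c, d}#} = cyc_edges xs + cyc_edges ys + {#{a, c}, {b, d}#}"
proof -
  obtain X where X: "X \<noteq> []" "mset X = mset xs" "cyc_edges X = cyc_edges xs" "last X = a" "hd X = b"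
    using assms(1) by (rule cyc_edges_rotate_to)
  obtain Y where Y: "Y \<noteq> []" "mset Y = mset ys" "cyc_edges Y = cyc_edges ys" "last Y = d" "hd Y = c"
    using assms(2)[unfolded insert_commute[of c]] by (rule cyc_edges_rotate_to)
  have "cyc_edges (X @ Y) + {#{a, b}, {c, d}#} = cyc_edges xs + cyc_edges ys + {#{a, c}, {b, d}#}"
    using X(1,4,5) Y(1,4,5)
    by (simp add: path_edges_append cyc_edges_path insert_commute flip: X(3) Y(3))
  then show ?thesis using X(1,2) Y(2) by (intro exI[of _ "X @ Y"]) auto
qed

text \<open>With three or more vertices no edge occurs twice. This connects the multisets used here
  with the sets of edges that define tours.\<close>

lemma distinct_cyc_edges:
  assumes "distinct xs" "3 \<le> length xs"
  shows "cyc_edges xs = mset_set (set_mset (cyc_edges xs))"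
proof -
  have 1: "cyc_pairs xs = mset_set (set_mset (cyc_pairs xs))"
    using assms(1) by (simp add: cyc_pairs_def mset_set_set distinct_zipI1)
  have 2: "inj_on (\<lambda>(x, y). {x, y}) (set_mset (cyc_pairs xs))"
    using cyc_pairs_asym(1)[OF assms] by (auto simp: inj_on_def doubleton_eq_iff)
  show ?thesis unfolding cyc_edges_def set_image_mset
    by (subst 1) (simp add: image_mset_mset_set[OF 2])
qed

lemma is_tour_iff:
  "is_tour n T \<longleftrightarrow> 3 \<le> n \<and> (\<exists>vs. distinct vs \<and> set vs = {..<n} \<and> T = set_mset (cyc_edges vs))"
proof -
  have *: "{{vs ! i, vs ! (Suc i mod n)} | i. i < n} = set_mset (cyc_edges vs)"
    if "distinct vs" "set vs = {..<n}" for vs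
  proof -
    have len: "length vs = n" using that by (metis card_lessThan distinct_card)
    have "set_mset (cyc_edges vs) = (\<lambda>(x, y). {x, y}) ` {(a, b). (a, b) \<in># cyc_pairs vs}"
      by (auto simp: cyc_edges_def)
    then show ?thesis unfolding cyc_pairs_nth len by auto
  qed
  have "(distinct vs \<and> set vs = {..<n} \<and> T = {{vs ! i, vs ! (Suc i mod n)} | i. i < n}) \<longleftrightarrow>
      (distinct vs \<and> set vs = {..<n} \<and> T = set_mset (cyc_edges vs))" for vs
  proof (cases "distinct vs \<and> set vs = {..<n}")
    case True
    then show ?thesis using *[of vs] by (simp only: simp_thms)
  qed blast
  then show ?thesis unfolding is_tour_def by (simp only: simp_thms)
qed

section \<open>Exchanging edges of a tour\<close>

abbreviation edge_of :: "'a \<times> 'a \<Rightarrow> 'a set" where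
  "edge_of e \<equiv> {fst e, snd e}"

definition links :: "('a \<times> 'a) list \<Rightarrow> 'a set multiset" where
  "links rs = image_mset (\<lambda>(e, f). {snd e, fst f}) (cyc_pairs rs)"

definition family_edges :: "'a list multiset \<Rightarrow> 'a set multiset" where
  "family_edges F = (\<Sum>ws\<in>#F. cyc_edges ws)"

lemma family_edges_simps [simp]:
  "family_edges (add_mset ws F) = cyc_edges ws + family_edges F"
  "family_edges (F + G) = family_edges F + family_edges G"
  "family_edges {#} = {#}"
  by (auto simp: family_edges_def)

lemma family_edges_mem: "x \<in># family_edges F \<longleftrightarrow> (\<exists>ws\<in>#F. x \<in># cyc_edges ws)"
  by (induction F) auto

lemma links_memI: "(e, f) \<in># cyc_pairs rs \<Longrightarrow> {snd e, fst f} \<in># links rs"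
  unfolding links_def by force

text \<open>Inserting \<open>e\<close> into the cyclic order replaces one link by two. Together with
  the removal of \<open>e\<close> this is the replacement of \<open>{a, b}\<close> and
  \<open>{c, d}\<close> by \<open>{a, c}\<close> and \<open>{b, d}\<close> that the switching lemmas
  perform.\<close>

lemma links_snoc:
  assumes "A \<noteq> []"
  shows "links (A @ [e]) + {#{snd (last A), fst (hd A)}#} =
    links A + {#{snd (last A), fst e}, {fst (hd A), snd e}#}"
  using assms
  by (simp add: links_def cyc_pairs_append[OF assms] cyc_pairs_path_pairs[OF assms] path_pairs_def insert_commute)

lemma rotate_to_last:
  assumes "e \<in> set rs" "2 \<le> length rs"
  obtains A where "A \<noteq> []" "mset (A @ [e]) = mset rs" "cyc_pairs (A @ [e]) = cyc_pairs rs"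
proof -
  obtain X Y where XY: "rs = X @ e # Y" using assms(1) by (meson split_list)
  show ?thesis
  proof (rule that[of "Y @ X"])
    show "Y @ X \<noteq> []" using XY assms(2) by auto
    show "mset ((Y @ X) @ [e]) = mset rs" using XY by simp
    show "cyc_pairs ((Y @ X) @ [e]) = cyc_pairs rs"
      using cyc_pairs_append_commute[of Y "X @ [e]"] XY by simp
  qed
qed

text \<open>\<open>vs\<close> is the tour that is modified, and \<open>P\<close> selects the vertices that occur as tails of the
  tour edges that may be removed. A removable edge is stored as a pair whose order is the direction in
  which the closed walk, not the tour, traverses it. A list \<open>rs\<close> of such edges stands for the exchange
  that removes them and links the end of each to the start of its cyclic successor in \<open>rs\<close>; the outcome
  is a multiset of cyclic lists that cover the vertices.\<close>

locale tour_exchange =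
  fixes vs :: "'a list" and P :: "'a \<Rightarrow> bool" and w :: "'a set \<Rightarrow> real"
  assumes dist: "distinct vs" and len: "3 \<le> length vs"
    and tri: "\<And>x y z. x \<in> set vs \<Longrightarrow> y \<in> set vs \<Longrightarrow> z \<in> set vs \<Longrightarrow>
      x \<noteq> y \<Longrightarrow> y \<noteq> z \<Longrightarrow> x \<noteq> z \<Longrightarrow> w {x, y} \<le> w {x, z} + w {z, y}"
begin

section \<open>Invariants of an exchange\<close>

text \<open>The two cases are traversal along and against the tour. In both, the tour edge leads
  from a vertex with \<open>P\<close> to one without.\<close>

definition oriented :: "'a \<times> 'a \<Rightarrow> bool" where
  "oriented e \<longleftrightarrow> (P (fst e) \<and> \<not> P (snd e) \<and> e \<in># cyc_pairs vs) \<or>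
     (\<not> P (fst e) \<and> P (snd e) \<and> prod.swap e \<in># cyc_pairs vs)"

definition cover :: "'a list multiset \<Rightarrow> bool" where
  "cover F \<longleftrightarrow> [] \<notin># F \<and> (\<Sum>ws\<in>#F. mset ws) = mset vs"

definition removable :: "('a \<times> 'a) list \<Rightarrow> bool" where
  "removable rs \<longleftrightarrow> rs \<noteq> [] \<and> distinct (map edge_of rs) \<and> (\<forall>e\<in>set rs. oriented e)"

text \<open>The balance says that the family is the tour minus the removed edges plus the links. The
  additive form avoids truncated subtraction of multisets.\<close>

definition state :: "('a \<times> 'a) list \<Rightarrow> 'a list multiset \<Rightarrow> bool" where
  "state rs F \<longleftrightarrow> removable rs \<and> cover F \<and>
     family_edges F + mset (map edge_of rs) = cyc_edges vs + links rs"

lemma oriented_mem_cyc_edges: "oriented e \<Longrightarrow> edge_of e \<in># cyc_edges vs"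
  by (cases e) (auto simp: oriented_def cyc_edges_mem)

lemma oriented_P: "oriented e \<Longrightarrow> P (snd e) \<longleftrightarrow> \<not> P (fst e)"
  by (auto simp: oriented_def)

lemma oriented_neq: "oriented e \<Longrightarrow> fst e \<noteq> snd e"
  by (auto simp: oriented_def)

lemma oriented_set: "oriented e \<Longrightarrow> fst e \<in> set vs" "oriented e \<Longrightarrow> snd e \<in> set vs"
  using oriented_mem_cyc_edges[of e] cyc_edges_mem_set[of "fst e" "snd e" vs] by auto

lemma removable_subseteq:
  assumes "removable rs"
  shows "mset (map edge_of rs) \<subseteq># cyc_edges vs"
proof -
  have "mset (map edge_of rs) = mset_set (edge_of ` set rs)"
    using assms mset_set_set[of "map edge_of rs"] by (simp add: removable_def)
  moreover have "edge_of ` set rs \<subseteq> set_mset (cyc_edges vs)"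
    using assms oriented_mem_cyc_edges unfolding removable_def by blast
  ultimately show ?thesis
    by (subst distinct_cyc_edges[OF dist len]) (simp add: subset_imp_msubset_mset_set)
qed

lemma removable_distinct: "removable rs \<Longrightarrow> distinct rs"
  by (auto simp: removable_def distinct_map)

text \<open>Tour successors and predecessors are unique: the only possible oriented edge at
  \<open>x\<close> is the tour edge leaving \<open>x\<close> if \<open>P x\<close> holds, and the
  one entering \<open>x\<close> otherwise. So removable edges form a matching.\<close>

lemma endpoint_unique:
  assumes "removable rs" "e \<in> set rs" "f \<in> set rs" "x \<in> edge_of e" "x \<in> edge_of f"
  shows "e = f"
proof -
  have o: "oriented e" "oriented f" using assms by (auto simp: removable_def)
  have "edge_of e = edge_of f"
  proof (cases "P x")
    case True
    then have "(x, if x = fst e then snd e else fst e) \<in># cyc_pairs vs"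
      "(x, if x = fst f then snd f else fst f) \<in># cyc_pairs vs"
      using o assms(4,5) oriented_neq[OF o(1)] oriented_neq[OF o(2)]
      by (cases e; cases f; auto simp: oriented_def)+
    from cyc_pairs_functional[OF dist this] show ?thesis
      using assms(4,5) by (auto split: if_splits)
  next
    case False
    then have "(if x = fst e then snd e else fst e, x) \<in># cyc_pairs vs"
      "(if x = fst f then snd f else fst f, x) \<in># cyc_pairs vs"
      using o assms(4,5) oriented_neq[OF o(1)] oriented_neq[OF o(2)]
      by (cases e; cases f; auto simp: oriented_def)+
    from cyc_pairs_injective[OF dist this] show ?thesis
      using assms(4,5) by (auto split: if_splits)
  qed
  then show ?thesis
    using assms(1-3) unfolding removable_def distinct_map by (meson inj_onD)
qed

lemma state_links_subseteq:
  assumes "state rs F"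
  shows "links rs \<subseteq># family_edges F"
proof -
  have eq: "family_edges F + mset (map edge_of rs) = cyc_edges vs + links rs"
    and s: "mset (map edge_of rs) \<subseteq># cyc_edges vs"
    using assms removable_subseteq by (auto simp: state_def)
  obtain T where T: "cyc_edges vs = mset (map edge_of rs) + T"
    using s by (meson mset_subset_eq_exists_conv)
  have "family_edges F = T + links rs" using eq unfolding T by (simp add: add_ac)
  then show ?thesis by simp
qed

lemma cover_disjoint:
  assumes "cover (add_mset ws (add_mset ws' F))"
  shows "set ws \<inter> set ws' = {}"
proof -
  obtain cs where "mset cs = (\<Sum>ws\<in>#F. mset ws)" using ex_mset by blast
  then have "mset vs = mset (ws @ ws' @ cs)" using assms by (simp add: cover_def)
  then have "distinct (ws @ ws' @ cs)" using dist mset_eq_imp_distinct_iff by blast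
  then show ?thesis by auto
qed

lemma cover_unique:
  assumes "cover F" "ws \<in># F" "ws' \<in># F" "x \<in> set ws" "x \<in> set ws'"
  shows "ws = ws'"
proof (rule ccontr)
  assume "ws \<noteq> ws'"
  then obtain F0 where "F = add_mset ws (add_mset ws' F0)"
    using assms(2,3) by (metis insert_noteq_member multi_member_split)
  then show False using assms cover_disjoint by blast
qed

lemma cover_set:
  assumes "cover F" "ws \<in># F"
  shows "set ws \<subseteq> set vs"
proof -
  obtain F0 where "F = add_mset ws F0" using assms(2) by (meson multi_member_split)
  then have "mset ws \<subseteq># mset vs"
    using assms(1) by (metis cover_def image_mset_add_mset mset_subset_eq_add_left sum_mset.insert)
  then show ?thesis using set_mset_mono by fastforce
qed

lemma cover_size_ge2:
  assumes "cover F" "2 \<le> size F"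
  obtains ws ws' where "ws \<in># F" "ws' \<in># F" "set ws \<inter> set ws' = {}"
proof -
  obtain ws F1 where F1: "F = add_mset ws F1" using assms(2) by (cases F) auto
  then obtain ws' F0 where "F = add_mset ws (add_mset ws' F0)" using assms(2) by (cases F1) auto
  moreover from this have "set ws \<inter> set ws' = {}" using assms(1) by (simp add: cover_disjoint)
  ultimately show ?thesis using that[of ws ws'] by simp
qed

text \<open>Two edges on one component are switched within it, which may split it; two edges on
  different components merge these.\<close>

lemma cover_switch:
  assumes "cover F" "{#{a, b}, {c, d}#} \<subseteq># family_edges F"
  shows "\<exists>F'. cover F' \<and> family_edges F' + {#{a, b}, {c, d}#} = family_edges F + {#{a, c}, {b, d}#}"
proof -
  have "{a, b} \<in># family_edges F" using assms(2) by (meson insert_subset_eq_iff)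
  then obtain ws where "ws \<in># F" and ab: "{a, b} \<in># cyc_edges ws" by (auto simp: family_edges_mem)
  then obtain F0 where F0: "F = add_mset ws F0" by (meson multi_member_split)
  have "{c, d} \<in># family_edges F - {#{a, b}#}"
    using assms(2) by (meson insert_subset_eq_iff mset_subset_eq_insertD)
  then have "{c, d} \<in># (cyc_edges ws - {#{a, b}#}) + family_edges F0"
    using ab by (simp add: F0 multiset_diff_union_assoc)
  then consider "{c, d} \<in># cyc_edges ws - {#{a, b}#}" | "{c, d} \<in># family_edges F0" by auto
  then show ?thesis
  proof cases
    case 1
    then have "{#{a, b}, {c, d}#} \<subseteq># cyc_edges ws"
      using ab by (simp add: insert_subset_eq_iff)
    from cyc_edges_switch[OF this] obtain G where G: "[] \<notin># G" "(\<Sum>ws\<in>#G. mset ws) = mset ws"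
      "family_edges G + {#{a, b}, {c, d}#} = cyc_edges ws + {#{a, c}, {b, d}#}"
      unfolding family_edges_def by blast
    have "cover (G + F0)" using assms(1) G by (simp add: cover_def F0)
    moreover have "family_edges (G + F0) + {#{a, b}, {c, d}#} = family_edges F + {#{a, c}, {b, d}#}"
      using G(3) unfolding F0 by (simp add: add_mset_commute)
    ultimately show ?thesis by blast
  next
    case 2
    then obtain ws' where "ws' \<in># F0" and cd: "{c, d} \<in># cyc_edges ws'" by (auto simp: family_edges_mem)
    then obtain F1 where F1: "F0 = add_mset ws' F1" by (meson multi_member_split)
    from cyc_edges_merge[OF ab cd] obtain zs where zs: "zs \<noteq> []" "mset zs = mset ws + mset ws'"
      "cyc_edges zs + {#{a, b}, {c, d}#} = cyc_edges ws + cyc_edges ws' + {#{a, c}, {b, d}#}" by blast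
    have "cover (add_mset zs F1)" using assms(1) zs by (simp add: cover_def F0 F1 add_ac)
    moreover have "family_edges (add_mset zs F1) + {#{a, b}, {c, d}#} = family_edges F + {#{a, c}, {b, d}#}"
      using zs(3) unfolding F0 F1 by (simp add: add_mset_commute add_ac)
    ultimately show ?thesis by blast
  qed
qed

text \<open>The separation of \<open>b\<close> from \<open>d\<close> puts the two edges on different
  components, so only the merging case remains.\<close>

lemma cover_merge:
  assumes "cover F" "{a, b} \<in># family_edges F" "{c, d} \<in># family_edges F"
    and sep: "\<And>ws. ws \<in># F \<Longrightarrow> \<not> (b \<in> set ws \<and> d \<in> set ws)"
  shows "\<exists>F'. cover F' \<and> size F = Suc (size F') \<and>
    family_edges F' + {#{a, b}, {c, d}#} = family_edges F + {#{a, c}, {b, d}#}"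
proof -
  obtain ws where ws: "ws \<in># F" and ab: "{a, b} \<in># cyc_edges ws"
    using assms(2) by (auto simp: family_edges_mem)
  obtain ws' where ws': "ws' \<in># F" and cd: "{c, d} \<in># cyc_edges ws'"
    using assms(3) by (auto simp: family_edges_mem)
  have "ws \<noteq> ws'" using sep[OF ws] cyc_edges_mem_set[OF ab] cyc_edges_mem_set[OF cd] by auto
  then obtain F1 where F1: "F = add_mset ws (add_mset ws' F1)"
    using ws ws' by (metis insert_noteq_member multi_member_split)
  from cyc_edges_merge[OF ab cd] obtain zs where zs: "zs \<noteq> []" "mset zs = mset ws + mset ws'"
    "cyc_edges zs + {#{a, b}, {c, d}#} = cyc_edges ws + cyc_edges ws' + {#{a, c}, {b, d}#}" by blast
  have "cover (add_mset zs F1)" using assms(1) zs by (simp add: cover_def F1 add_ac)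
  moreover have "family_edges (add_mset zs F1) + {#{a, b}, {c, d}#} = family_edges F + {#{a, c}, {b, d}#}"
    using zs(3) unfolding F1 by (simp add: add_mset_commute add_ac)
  ultimately show ?thesis using F1 by auto
qed

section \<open>Existence of exchanges and the number of components\<close>

text \<open>The cover is built by appending the edges one at a time: by \<open>links_snoc\<close>, a
  single switch splices each new edge into the closing link.\<close>

lemma ex_state:
  assumes "removable rs"
  shows "\<exists>F. state rs F"
proof -
  have "rs \<noteq> []" using assms by (simp add: removable_def)
  then show ?thesis using assms
  proof (induction rs rule: rev_nonempty_induct)
    case (single e)
    \<comment> \<open>The only link of a single edge joins its own ends, so the tour itself is the
      outcome.\<close>
    have "cover {#vs#}" using len by (auto simp: cover_def)
    then have "state [e] {#vs#}"
      using single by (auto simp: state_def links_def cyc_pairs_def insert_commute)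
    then show ?case ..
  next
    case (snoc e rs)
    have r: "removable rs" using snoc by (auto simp: removable_def)
    then obtain F where F: "state rs F" using snoc.IH by blast
    let ?a = "snd (last rs)" and ?b = "fst (hd rs)"
    have sub: "mset (map edge_of (rs @ [e])) \<subseteq># cyc_edges vs"
      using snoc.prems by (rule removable_subseteq)
    \<comment> \<open>The edge \<open>e\<close> has not been removed yet, so the family contains it
      in addition to all links, even if one of these coincides with it.\<close>
    then have "mset (map edge_of rs) + {#edge_of e#} \<subseteq># cyc_edges vs" by simp
    then obtain T where T: "cyc_edges vs = mset (map edge_of rs) + {#edge_of e#} + T"
      unfolding mset_subset_eq_exists_conv ..
    have eq: "family_edges F + mset (map edge_of rs) = cyc_edges vs + links rs"
      using F by (simp add: state_def)
    then have feq: "family_edges F = {#edge_of e#} + T + links rs"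
      unfolding T by (simp add: add_ac)
    have "{?a, ?b} \<in># links rs"
      using snoc.hyps by (simp add: links_def cyc_pairs_path_pairs)
    then obtain L where L: "links rs = add_mset {?a, ?b} L" by (meson multi_member_split)
    have "family_edges F = {#{?a, ?b}, edge_of e#} + (T + L)"
      unfolding feq L by (simp add: add_mset_commute)
    then have "{#{?a, ?b}, edge_of e#} \<subseteq># family_edges F"
      by (simp only: mset_subset_eq_add_left)
    from cover_switch[OF _ this] F obtain F' where F': "cover F'"
      "family_edges F' + {#{?a, ?b}, {fst e, snd e}#} = family_edges F + {#{?a, fst e}, {?b, snd e}#}"
      by (auto simp: state_def)
    have l: "links (rs @ [e]) + {#{?a, ?b}#} = links rs + {#{?a, fst e}, {?b, snd e}#}"
      by (rule links_snoc[OF snoc.hyps])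
    have "family_edges F' + mset (map edge_of (rs @ [e])) = cyc_edges vs + links (rs @ [e])"
    proof -
      have "family_edges F' + mset (map edge_of (rs @ [e])) + {#{?a, ?b}#}
          = (family_edges F' + {#{?a, ?b}, edge_of e#}) + mset (map edge_of rs)"
        by (simp add: add_ac add_mset_commute)
      also have "\<dots> = (family_edges F + mset (map edge_of rs)) + {#{?a, fst e}, {?b, snd e}#}"
        unfolding F'(2) by (simp only: add_ac)
      also have "\<dots> = cyc_edges vs + (links rs + {#{?a, fst e}, {?b, snd e}#})"
        unfolding eq by (simp only: add_ac)
      also have "\<dots> = cyc_edges vs + links (rs @ [e]) + {#{?a, ?b}#}"
        unfolding l[symmetric] by (simp only: add_ac)
      finally show ?thesis by (rule add_right_imp_eq)
    qed
    then show ?case using F'(1) snoc.prems by (auto simp: state_def)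
  qed
qed

lemma cyc_edge_cases:
  assumes "state rs F" "{x, y} \<in># cyc_edges vs"
  shows "(\<exists>e\<in>set rs. {x, y} = edge_of e) \<or> {x, y} \<in># family_edges F"
proof -
  have "{x, y} \<in># family_edges F + mset (map edge_of rs)"
    using assms by (simp add: state_def)
  then show ?thesis by auto
qed

text \<open>If the ends of every removed edge shared a component, then no tour edge, removed or not,
  would leave a component, and following the tour from one component would never reach
  another.\<close>

lemma ex_separated_edge:
  assumes st: "state rs F" and "2 \<le> size F"
  shows "\<exists>e\<in>set rs. \<forall>ws\<in>#F. \<not> (fst e \<in> set ws \<and> snd e \<in> set ws)"
proof (rule ccontr)
  assume "\<not> ?thesis"
  then have conn: "\<And>e. e \<in> set rs \<Longrightarrow> \<exists>ws\<in>#F. fst e \<in> set ws \<and> snd e \<in> set ws" by blast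
  have cov: "cover F" using st by (simp add: state_def)
  then obtain ws ws' where ws: "ws \<in># F" "ws' \<in># F" "set ws \<inter> set ws' = {}"
    using assms(2) by (rule cover_size_ge2)
  have ne: "ws \<noteq> []" "ws' \<noteq> []" using ws cov by (auto simp: cover_def)
  have "hd ws \<in> set vs" using cover_set[OF cov ws(1)] ne by auto
  then have "set vs \<subseteq> set ws"
  proof (rule cyc_pairs_closed)
    show "hd ws \<in> set ws" using ne by simp
    fix a b assume ab: "(a, b) \<in># cyc_pairs vs" and a: "a \<in> set ws"
    have "\<exists>us\<in>#F. a \<in> set us \<and> b \<in> set us"
      using cyc_edge_cases[OF st, of a b] ab conn
      by (auto simp: cyc_edges_mem family_edges_mem doubleton_eq_iff dest!: cyc_pairs_mem_set)
    then show "b \<in> set ws" using cover_unique[OF cov ws(1)] a by blast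
  qed
  then show False using cover_set[OF cov ws(2)] ws(3) ne by (cases ws') auto
qed

text \<open>A component without a tail of a removed edge would be closed under tour successors and
  thus contain every vertex. The link at a tail leads to a second tail, since \<open>cons\<close>
  makes links join ends with equal \<open>P\<close> and the removed edges form a matching.\<close>

lemma component_two_tails:
  assumes st: "state rs F" and cons: "\<And>e f. (e, f) \<in># cyc_pairs rs \<Longrightarrow> P (snd e) = P (fst f)"
    and ws: "ws \<in># F"
  shows "\<exists>x\<in>set ws. \<exists>y\<in>set ws. x \<noteq> y \<and> P x \<and> P y \<and> (\<exists>e\<in>set rs. x \<in> edge_of e) \<and> (\<exists>e\<in>set rs. y \<in> edge_of e)"
proof -
  have cov: "cover F" and rem: "removable rs" using st by (auto simp: state_def)
  have "ws \<noteq> []" using ws cov by (auto simp: cover_def)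
  have "\<exists>x\<in>set ws. P x \<and> (\<exists>e\<in>set rs. x \<in> edge_of e)"
  proof (rule ccontr)
    assume no: "\<not> ?thesis"
    have "hd ws \<in> set vs" using cover_set[OF cov ws] \<open>ws \<noteq> []\<close> by auto
    then have "set vs \<subseteq> set ws"
    proof (rule cyc_pairs_closed)
      show "hd ws \<in> set ws" using \<open>ws \<noteq> []\<close> by simp
      fix a b assume ab: "(a, b) \<in># cyc_pairs vs" and a: "a \<in> set ws"
      have "{a, b} \<in># family_edges F"
      proof (rule ccontr)
        assume "\<not> ?thesis"
        then obtain e where e: "e \<in> set rs" "{a, b} = edge_of e"
          using cyc_edge_cases[OF st, of a b] ab by (auto simp: cyc_edges_mem)
        have "oriented e" using e rem by (auto simp: removable_def)
        then have "P a" using e ab cyc_pairs_asym[OF dist len]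
          by (cases e) (auto simp: oriented_def doubleton_eq_iff)
        then show False using no a e by blast
      qed
      then obtain us where us: "us \<in># F" "a \<in> set us" "b \<in> set us"
        using cyc_edges_mem_set unfolding family_edges_mem by metis
      then show "b \<in> set ws" using cover_unique[OF cov ws us(1) a us(2)] by blast
    qed
    moreover obtain e where e: "e \<in> set rs" using rem by (cases rs) (auto simp: removable_def)
    then have "oriented e" using rem by (simp add: removable_def)
    then obtain x where "x \<in> edge_of e" "P x" "x \<in> set vs"
      using oriented_P[of e] oriented_set[of e] by blast
    ultimately show False using no e by blast
  qed
  then obtain x e where x: "x \<in> set ws" "P x" "e \<in> set rs" "x \<in> edge_of e" by blast
  have o: "oriented e" using x rem by (simp add: removable_def)
  have "\<exists>f\<in>set rs. \<exists>y\<in>edge_of f. P y \<and> x \<noteq> y \<and> {x, y} \<in># links rs"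
  proof (cases "x = snd e")
    case True
    obtain f where f: "(e, f) \<in># cyc_pairs rs" using cyc_pairs_ex_succ[OF x(3)] by blast
    have fr: "f \<in> set rs" using cyc_pairs_mem_set[OF f] by simp
    have "P (fst f)" using cons[OF f] x True by simp
    moreover have "fst f \<noteq> snd e"
    proof
      assume "fst f = snd e"
      then have "e = f" using endpoint_unique[OF rem x(3) fr, of "fst f"] by simp
      then show False using \<open>fst f = snd e\<close> oriented_neq[OF o] by simp
    qed
    moreover have "{x, fst f} \<in># links rs" using links_memI[OF f] True by simp
    ultimately show ?thesis using fr True by (intro bexI[of _ f] bexI[of _ "fst f"]) simp_all
  next
    case False
    then have xe: "x = fst e" using x by simp
    obtain f where f: "(f, e) \<in># cyc_pairs rs" using cyc_pairs_ex_pred[OF x(3)] by blast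
    have fr: "f \<in> set rs" using cyc_pairs_mem_set[OF f] by simp
    have "P (snd f)" using cons[OF f] x xe by simp
    moreover have "snd f \<noteq> fst e"
    proof
      assume "snd f = fst e"
      then have "e = f" using endpoint_unique[OF rem x(3) fr, of "snd f"] by simp
      then show False using \<open>snd f = fst e\<close> oriented_neq[OF o] by simp
    qed
    moreover have "{x, snd f} \<in># links rs" using links_memI[OF f] xe by (simp add: insert_commute)
    ultimately show ?thesis using fr xe by (intro bexI[of _ f] bexI[of _ "snd f"]) simp_all
  qed
  then obtain f y where y: "f \<in> set rs" "y \<in> edge_of f" "P y" "x \<noteq> y" "{x, y} \<in># links rs" by blast
  have "{x, y} \<in># family_edges F" using y(5) state_links_subseteq[OF st] by (rule mset_subset_eqD[rotated])
  then obtain us where us: "us \<in># F" "x \<in> set us" "y \<in> set us"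
    using cyc_edges_mem_set unfolding family_edges_mem by metis
  then have "y \<in> set ws" using cover_unique[OF cov ws us(1) x(1) us(2)] by simp
  then show ?thesis using x y by blast
qed

text \<open>Each removed edge has exactly one end satisfying \<open>P\<close>, so at most
  \<open>length rs\<close> tails are shared out among disjoint components that hold at least two
  each.\<close>

lemma size_cover_le:
  assumes st: "state rs F" and cons: "\<And>e f. (e, f) \<in># cyc_pairs rs \<Longrightarrow> P (snd e) = P (fst f)"
  shows "2 * size F \<le> length rs"
proof -
  define U where "U = {x. P x \<and> (\<exists>e\<in>set rs. x \<in> edge_of e)}"
  have cov: "cover F" and rem: "removable rs" using st by (auto simp: state_def)
  have "U \<subseteq> (\<lambda>e. if P (fst e) then fst e else snd e) ` set rs"
  proof
    fix x assume "x \<in> U"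
    then obtain e where e: "P x" "e \<in> set rs" "x \<in> edge_of e" by (auto simp: U_def)
    then have "P (snd e) \<longleftrightarrow> \<not> P (fst e)" using rem by (intro oriented_P) (simp add: removable_def)
    then have "x = (if P (fst e) then fst e else snd e)" using e by auto
    then show "x \<in> (\<lambda>e. if P (fst e) then fst e else snd e) ` set rs" using e(2) by blast
  qed
  then have "finite U" "card U \<le> card (set rs)"
    by (blast intro: finite_subset, intro surj_card_le) simp
  then have "finite U" "card U \<le> length rs" using card_length[of rs] by auto
  have "2 * size G \<le> size (filter_mset (\<lambda>x. x \<in> U) (\<Sum>ws\<in>#G. mset ws))" if "G \<subseteq># F" for G
    using that
  proof (induction G)
    case (add ws G)
    have "ws \<in># F" using add.prems by (meson insert_subset_eq_iff)
    then obtain x y where xy: "x \<in> set ws" "y \<in> set ws" "x \<noteq> y" "x \<in> U" "y \<in> U"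
      using component_two_tails[OF st cons] unfolding U_def by blast
    then have "mset_set {x, y} \<subseteq># filter_mset (\<lambda>x. x \<in> U) (mset ws)"
      by (intro subset_mset.order_trans[OF subset_imp_msubset_mset_set mset_set_set_mset_msubset]) auto
    from size_mset_mono[OF this] have "2 \<le> size (filter_mset (\<lambda>x. x \<in> U) (mset ws))"
      using xy(3) by simp
    moreover have "G \<subseteq># F"
      using add.prems by (rule subset_mset.order_trans[rotated]) simp
    ultimately show ?case using add.IH by simp
  qed simp
  from this[OF subset_mset.order_refl] have "2 * size F \<le> size (filter_mset (\<lambda>x. x \<in> U) (mset vs))"
    using cov by (simp add: cover_def)
  also have "\<dots> = card (set (filter (\<lambda>x. x \<in> U) vs))"
    using dist by (metis distinct_card distinct_filter mset_filter size_mset)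
  also have "\<dots> \<le> card U" using \<open>finite U\<close> by (intro card_mono) auto
  finally show ?thesis using \<open>card U \<le> length rs\<close> by simp
qed

section \<open>Putting removed edges back\<close>

text \<open>This runs the step of \<open>ex_state\<close> backwards: undoing the switch that spliced
  in \<open>e\<close> preserves the balance for the shorter list \<open>A\<close>.\<close>

lemma state_remove:
  assumes A: "A \<noteq> []" and st: "state rs F"
    and rs: "mset (A @ [e]) = mset rs" "cyc_pairs (A @ [e]) = cyc_pairs rs"
    and F': "cover F'"
      "family_edges F' + {#{snd (last A), fst e}, {fst (hd A), snd e}#} =
       family_edges F + {#{snd (last A), fst (hd A)}, edge_of e#}"
  shows "state A F'"
proof -
  let ?X = "{#{snd (last A), fst e}, {fst (hd A), snd e}#}" and ?y = "{#{snd (last A), fst (hd A)}#}"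
  have l: "links rs + ?y = links A + ?X"
    using links_snoc[OF A, of e] rs(2) by (simp add: links_def)
  have m: "mset (map edge_of rs) = mset (map edge_of A) + {#edge_of e#}"
    using arg_cong[OF rs(1), of "image_mset edge_of"] by simp
  have eq: "family_edges F + mset (map edge_of rs) = cyc_edges vs + links rs"
    using st by (simp add: state_def)
  have "family_edges F' + mset (map edge_of A) + ?X = (family_edges F' + ?X) + mset (map edge_of A)"
    by (simp only: add_ac)
  also have "\<dots> = family_edges F + mset (map edge_of rs) + ?y"
    unfolding F'(2) m by (simp add: add_ac add_mset_commute)
  also have "\<dots> = cyc_edges vs + (links rs + ?y)"
    unfolding eq by (simp only: add_ac)
  also have "\<dots> = cyc_edges vs + links A + ?X"
    unfolding l by (simp only: add_ac)
  finally have "family_edges F' + mset (map edge_of A) = cyc_edges vs + links A"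
    by (rule add_right_imp_eq)
  moreover have "removable A"
  proof -
    have r: "removable rs" using st by (simp add: state_def)
    have "mset (map edge_of (A @ [e])) = mset (map edge_of rs)"
      unfolding mset_map rs(1) ..
    then have "distinct (map edge_of (A @ [e]))"
      using r mset_eq_imp_distinct_iff unfolding removable_def by blast
    moreover have "set A \<subseteq> set rs" using mset_eq_setD[OF rs(1)] by auto
    ultimately show ?thesis using r A by (auto simp: removable_def)
  qed
  ultimately show ?thesis using F'(1) by (simp add: state_def)
qed

text \<open>The edge put back has its ends on different components. The two links at these ends then
  lie on different components too, and trading them for \<open>e\<close> and a link that bypasses
  \<open>e\<close> merges the two.\<close>

lemma merge_step:
  assumes st: "state rs F" and "2 \<le> size F" "2 \<le> length rs"
  shows "\<exists>A e F'. A \<noteq> [] \<and> mset (A @ [e]) = mset rs \<and> cyc_pairs (A @ [e]) = cyc_pairs rs \<and>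
    state A F' \<and> size F = Suc (size F')"
proof -
  obtain e where e: "e \<in> set rs" "\<forall>ws\<in>#F. \<not> (fst e \<in> set ws \<and> snd e \<in> set ws)"
    using ex_separated_edge[OF st assms(2)] by blast
  obtain A where A: "A \<noteq> []" "mset (A @ [e]) = mset rs" "cyc_pairs (A @ [e]) = cyc_pairs rs"
    using e(1) assms(3) by (rule rotate_to_last)
  have cp: "(last A, e) \<in># cyc_pairs rs" "(e, hd A) \<in># cyc_pairs rs"
    using A(1) by (auto simp flip: A(3) simp: cyc_pairs_append)
  have "{snd (last A), fst e} \<in># family_edges F" "{fst (hd A), snd e} \<in># family_edges F"
    using links_memI[OF cp(1)] links_memI[OF cp(2)] state_links_subseteq[OF st]
    by (auto simp: insert_commute dest: mset_subset_eqD)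
  then obtain F' where F': "cover F'" "size F = Suc (size F')"
      "family_edges F' + {#{snd (last A), fst e}, {fst (hd A), snd e}#} =
       family_edges F + {#{snd (last A), fst (hd A)}, edge_of e#}"
    using cover_merge[of F "snd (last A)" "fst e" "fst (hd A)" "snd e"] e(2) st
    by (auto simp: state_def)
  then show ?thesis using A state_remove[OF A(1) st A(2,3) F'(1,3)] by blast
qed

text \<open>An edge that starts outside \<open>P\<close> ends in \<open>P\<close>. If no link joined
  two vertices of \<open>P\<close>, its successor would again start outside \<open>P\<close>, and so
  on around the whole list.\<close>

lemma removable_both_types_link:
  assumes "e \<in> set rs" "P (fst e)" "f \<in> set rs" "\<not> P (fst f)"
    and "removable rs"
  shows "\<exists>p q. (p, q) \<in># cyc_pairs rs \<and> P (snd p) \<and> P (fst q)"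
proof (rule ccontr)
  assume no: "\<not> ?thesis"
  have "set rs \<subseteq> {e. \<not> P (fst e)}"
  proof (rule cyc_pairs_closed[OF assms(3)])
    show "f \<in> {e. \<not> P (fst e)}" using assms by simp
    fix a b assume ab: "(a, b) \<in># cyc_pairs rs" and "a \<in> {e. \<not> P (fst e)}"
    moreover have "oriented a" using cyc_pairs_mem_set[OF ab] assms(5) by (simp add: removable_def)
    ultimately show "b \<in> {e. \<not> P (fst e)}" using no oriented_P by blast
  qed
  then show False using assms by auto
qed

text \<open>If every edge of \<open>rs\<close> were to split the tour \<open>ws\<close>, then \<open>ws\<close> would traverse
  all pieces of \<open>vs\<close> in the same direction, which a link between two tails forbids.\<close>

lemma ex_reversing_edge:
  assumes st: "state rs {#ws#}"
    and types: "e1 \<in> set rs" "P (fst e1)" "e2 \<in> set rs" "\<not> P (fst e2)"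
  shows "\<exists>p e q. (p, e) \<in># cyc_pairs rs \<and> (e, q) \<in># cyc_pairs rs \<and>
    ((snd p, fst e) \<in># cyc_pairs ws \<and> (fst q, snd e) \<in># cyc_pairs ws \<or>
     (fst e, snd p) \<in># cyc_pairs ws \<and> (snd e, fst q) \<in># cyc_pairs ws)"
proof (rule ccontr)
  assume no: "\<not> ?thesis"
  have rem: "removable rs" and cov: "cover {#ws#}" using st by (auto simp: state_def)
  have mws: "mset ws = mset vs" using cov by (simp add: cover_def)
  have dws: "distinct ws" "3 \<le> length ws" and sws: "set ws = set vs"
    using mws dist len mset_eq_imp_distinct_iff mset_eq_length mset_eq_setD by (blast, metis, blast)
  note fw = cyc_pairs_functional[OF dws(1)] and iw = cyc_pairs_injective[OF dws(1)]
  note fv = cyc_pairs_functional[OF dist] and iv = cyc_pairs_injective[OF dist]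
    and av = cyc_pairs_asym[OF dist len] and aw = cyc_pairs_asym[OF dws]
  \<comment> \<open>\<open>lk\<close> is adjacency by a link, and \<open>T0\<close> is adjacency by
    a surviving tour edge directed along \<open>vs\<close>. \<open>Out\<close> and \<open>In\<close>
    describe the neighbours in \<open>ws\<close> that stand for the tour successor and predecessor:
    a link replaces the successor at the tail of a removed edge and the predecessor at its
    head.\<close>
  define lk where "lk x y \<longleftrightarrow> (\<exists>e f. (e, f) \<in># cyc_pairs rs \<and>
    (x = snd e \<and> y = fst f \<or> x = fst f \<and> y = snd e))" for x y
  define T0 where "T0 x y \<longleftrightarrow> (x, y) \<in># cyc_pairs vs \<and> {x, y} \<notin> edge_of ` set rs" for x y
  define Out where "Out x y \<longleftrightarrow> T0 x y \<or> P x \<and> lk x y" for x y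
  define In where "In x y \<longleftrightarrow> T0 y x \<or> \<not> P x \<and> lk x y" for x y
  have lk_sym: "lk x y \<Longrightarrow> lk y x" for x y unfolding lk_def by blast
  have lk_links: "{x, y} \<in># links rs" if "lk x y" for x y
    using that links_memI[of _ _ rs] unfolding lk_def by (metis insert_commute)
  have eq: "cyc_edges ws + mset (map edge_of rs) = cyc_edges vs + links rs"
    using st by (simp add: state_def)
  have lk_ws: "{x, y} \<in># cyc_edges ws" if "lk x y" for x y
    using lk_links[OF that] state_links_subseteq[OF st] by (auto dest: mset_subset_eqD)
  have T0_ws: "{x, y} \<in># cyc_edges ws" if "T0 x y" for x y
    using cyc_edge_cases[OF st, of x y] that by (auto simp: T0_def cyc_edges_mem)
  \<comment> \<open>A link equal to a surviving tour edge would occur twice in \<open>ws\<close>,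
    which repeats no edge.\<close>
  have lk_T0: False if "lk x y" "T0 x y" for x y
  proof -
    have "count (mset (map edge_of rs)) {x, y} = 0"
      using that(2) by (auto simp: T0_def count_eq_zero_iff)
    moreover have "count (links rs) {x, y} \<ge> 1" using lk_links[OF that(1)] by (simp add: Suc_le_eq)
    moreover have "count (cyc_edges vs) {x, y} \<ge> 1"
      using that(2) by (simp add: T0_def cyc_edges_mem Suc_le_eq)
    moreover have "count (cyc_edges ws) {x, y} \<le> 1"
      by (subst distinct_cyc_edges[OF dws]) (simp add: count_mset_set')
    ultimately show False using arg_cong[OF eq, of "\<lambda>M. count M {x, y}"]
      unfolding count_union by linarith
  qed
  have adj: "(x, y) \<in># cyc_pairs ws \<or> (y, x) \<in># cyc_pairs ws" if "Out x y \<or> In x y" for x y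
    using that lk_ws[of x y] T0_ws[of x y] T0_ws[of y x]
    unfolding Out_def In_def by (auto simp: cyc_edges_mem)
  have neq: "y \<noteq> z" if "Out x y" "In x z" for x y z
    using that lk_T0[of x y] lk_T0[of y x] lk_sym[of x y] av(1)[of x y]
    unfolding Out_def In_def T0_def by auto
  have lk_ex: "\<exists>y. lk x y" if x: "x \<in> edge_of e" and e: "e \<in> set rs" for x e
  proof -
    obtain p q where "(p, e) \<in># cyc_pairs rs" "(e, q) \<in># cyc_pairs rs"
      using cyc_pairs_ex_pred[OF e] cyc_pairs_ex_succ[OF e] by blast
    then show ?thesis using x unfolding lk_def by blast
  qed
  have tail_P: "P x \<and> \<not> P y" if "(x, y) \<in># cyc_pairs vs" "e \<in> set rs" "{x, y} = edge_of e" for x y e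
  proof -
    have "oriented e" using that(2) rem by (simp add: removable_def)
    then show ?thesis using that(1,3) av[of x y]
      by (cases e) (auto simp: oriented_def doubleton_eq_iff)
  qed
  have Out_ex: "\<exists>y. Out x y" if "x \<in> set vs" for x
  proof -
    obtain y where y: "(x, y) \<in># cyc_pairs vs" using cyc_pairs_ex_succ[OF \<open>x \<in> set vs\<close>] by blast
    show ?thesis
    proof (cases "{x, y} \<in> edge_of ` set rs")
      case True
      then obtain e where e: "e \<in> set rs" "{x, y} = edge_of e" by blast
      then have "P x" using tail_P[OF y] by blast
      moreover have "x \<in> edge_of e" using e(2) by blast
      ultimately show ?thesis using lk_ex[OF _ e(1)] unfolding Out_def by blast
    next
      case False
      then show ?thesis using y unfolding Out_def T0_def by blast
    qed
  qed
  have In_ex: "\<exists>y. In x y" if "x \<in> set vs" for x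
  proof -
    obtain y where y: "(y, x) \<in># cyc_pairs vs" using cyc_pairs_ex_pred[OF \<open>x \<in> set vs\<close>] by blast
    show ?thesis
    proof (cases "{y, x} \<in> edge_of ` set rs")
      case True
      then obtain e where e: "e \<in> set rs" "{y, x} = edge_of e" by blast
      then have "\<not> P x" using tail_P[OF y] by blast
      moreover have "x \<in> edge_of e" using e(2) by blast
      ultimately show ?thesis using lk_ex[OF _ e(1)] unfolding In_def by blast
    next
      case False
      then show ?thesis using y unfolding In_def T0_def by blast
    qed
  qed
  \<comment> \<open>\<open>A\<close> collects the vertices at which \<open>ws\<close> runs in the
    direction of \<open>vs\<close>. By \<open>neq\<close> the \<open>In\<close> neighbour of such a
    vertex comes directly before it.\<close>
  define A where "A = {x. \<exists>y. Out x y \<and> (x, y) \<in># cyc_pairs ws}"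
  have A_In: "(z, x) \<in># cyc_pairs ws" if "x \<in> A" "In x z" for x z
    using that adj[of x z] neq[of x _ z] fw[of x z] unfolding A_def by blast
  have A_Out: "(x, y) \<in># cyc_pairs ws" if "x \<in> A" "x \<in> set vs" "Out x y" for x y
    using that In_ex[of x] A_In[of x] adj[of x y] neq[of x y] iw[of _ x y] by blast
  have In_A: "x \<in> A" if "In x z" "(z, x) \<in># cyc_pairs ws" "x \<in> set vs" for x z
    using that Out_ex[of x] adj[of x] neq[of x _ z] iw[of z x] unfolding A_def by blast
  have closed: "b \<in> A" if ab: "(a, b) \<in># cyc_pairs vs" and a: "a \<in> A" for a b
  proof -
    have set: "a \<in> set vs" "b \<in> set vs" using cyc_pairs_mem_set[OF ab] by auto
    show ?thesis
    proof (cases "{a, b} \<in> edge_of ` set rs")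
      case False
      then have "Out a b" "In b a" using ab by (auto simp: Out_def In_def T0_def)
      then show ?thesis using In_A A_Out a set by blast
    next
      \<comment> \<open>Across a removed edge, \<open>no\<close> forbids \<open>ws\<close> to leave
        both ends by their links, so \<open>ws\<close> enters the head by its link and membership in
        \<open>A\<close> passes from the tail to the head.\<close>
      case True
      then obtain e where e: "e \<in> set rs" "{a, b} = edge_of e" by blast
      have Pab: "P a" "\<not> P b" using tail_P[OF ab e] by auto
      obtain p q where pq: "(p, e) \<in># cyc_pairs rs" "(e, q) \<in># cyc_pairs rs"
        using cyc_pairs_ex_pred[OF e(1)] cyc_pairs_ex_succ[OF e(1)] by blast
      have l: "lk (fst e) (snd p)" "lk (snd e) (fst q)"
        using pq unfolding lk_def by blast+
      have n: "\<not> ((snd p, fst e) \<in># cyc_pairs ws \<and> (fst q, snd e) \<in># cyc_pairs ws)"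
        "\<not> ((fst e, snd p) \<in># cyc_pairs ws \<and> (snd e, fst q) \<in># cyc_pairs ws)"
        using no pq by blast+
      consider "a = fst e" "b = snd e" | "a = snd e" "b = fst e"
        using e(2) by (auto simp: doubleton_eq_iff)
      then show ?thesis
      proof cases
        case 1
        then have o: "Out a (snd p)" and i: "In b (fst q)" using l Pab by (auto simp: Out_def In_def)
        then have "(a, snd p) \<in># cyc_pairs ws" using A_Out a set by blast
        then have "(fst q, b) \<in># cyc_pairs ws" using n(2) adj[of b "fst q"] i 1 by blast
        then show ?thesis using In_A i set by blast
      next
        case 2
        then have o: "Out a (fst q)" and i: "In b (snd p)" using l Pab by (auto simp: Out_def In_def)
        then have "(a, fst q) \<in># cyc_pairs ws" using A_Out a set by blast
        then have "(snd p, b) \<in># cyc_pairs ws" using n(2) adj[of b "snd p"] i 2 by blast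
        then show ?thesis using In_A i set by blast
      qed
    qed
  qed
  \<comment> \<open>A link between two tails is the \<open>Out\<close> edge of both its ends, so
    \<open>ws\<close> would traverse it in both directions.\<close>
  obtain p q where pq: "(p, q) \<in># cyc_pairs rs" "P (snd p)" "P (fst q)"
    using removable_both_types_link[OF types rem] by blast
  have "oriented p" "oriented q" using cyc_pairs_mem_set[OF pq(1)] rem by (auto simp: removable_def)
  then have sv: "snd p \<in> set vs" "fst q \<in> set vs" by (auto intro: oriented_set)
  have o: "Out (snd p) (fst q)" "Out (fst q) (snd p)"
    using pq unfolding Out_def lk_def by blast+
  have "snd p \<in> A \<or> fst q \<in> A" using adj[of "snd p" "fst q"] o unfolding A_def by blast
  then have "set vs \<subseteq> A" using cyc_pairs_closed[OF sv(1)] cyc_pairs_closed[OF sv(2)] closed by blast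
  then have "(snd p, fst q) \<in># cyc_pairs ws" "(fst q, snd p) \<in># cyc_pairs ws"
    using A_Out sv o by blast+
  then show False using aw(1) by blast
qed

text \<open>Once a single tour is left, the edge from \<open>ex_reversing_edge\<close> is put back
  by a 2-opt move, which yields a single tour again.\<close>

lemma reverse_step:
  assumes st: "state rs {#ws#}" and "2 \<le> length rs"
    and types: "e1 \<in> set rs" "P (fst e1)" "e2 \<in> set rs" "\<not> P (fst e2)"
  shows "\<exists>A e zs. A \<noteq> [] \<and> mset (A @ [e]) = mset rs \<and> cyc_pairs (A @ [e]) = cyc_pairs rs \<and>
    state A {#zs#}"
proof -
  have rem: "removable rs" and cov: "cover {#ws#}" using st by (auto simp: state_def)
  obtain p e q where pe: "(p, e) \<in># cyc_pairs rs" "(e, q) \<in># cyc_pairs rs" and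
    dir: "(snd p, fst e) \<in># cyc_pairs ws \<and> (fst q, snd e) \<in># cyc_pairs ws \<or>
     (fst e, snd p) \<in># cyc_pairs ws \<and> (snd e, fst q) \<in># cyc_pairs ws"
    using ex_reversing_edge[OF st types] by blast
  have e: "e \<in> set rs" using cyc_pairs_mem_set[OF pe(1)] by simp
  obtain A where A: "A \<noteq> []" "mset (A @ [e]) = mset rs" "cyc_pairs (A @ [e]) = cyc_pairs rs"
    using e assms(2) by (rule rotate_to_last)
  have cp: "(last A, e) \<in># cyc_pairs rs" "(e, hd A) \<in># cyc_pairs rs"
    using A(1) by (auto simp flip: A(3) simp: cyc_pairs_append)
  have pq: "p = last A" "q = hd A"
    using cyc_pairs_injective[OF removable_distinct[OF rem] pe(1) cp(1)]
      cyc_pairs_functional[OF removable_distinct[OF rem] pe(2) cp(2)] by auto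
  have "oriented e" using e rem by (simp add: removable_def)
  then have "fst e \<noteq> snd e" by (rule oriented_neq)
  then have "\<exists>zs. mset zs = mset ws \<and> cyc_edges zs + {#{snd p, fst e}, {fst q, snd e}#} =
      cyc_edges ws + {#{snd p, fst q}, {fst e, snd e}#}"
    using dir cyc_edges_reverse_switch[of "snd p" "fst e" ws "fst q" "snd e"]
      cyc_edges_reverse_switch[of "fst e" "snd p" ws "snd e" "fst q"]
    by (auto simp: insert_commute add_mset_commute)
  then obtain zs where zs: "mset zs = mset ws" "cyc_edges zs + {#{snd p, fst e}, {fst q, snd e}#} =
      cyc_edges ws + {#{snd p, fst q}, {fst e, snd e}#}" by blast
  have "cover {#zs#}" using cov zs(1) by (auto simp: cover_def)
  then have "state A {#zs#}"
    by (rule state_remove[OF A(1) st A(2,3)]) (use zs(2) in \<open>simp add: pq\<close>)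
  then show ?thesis using A by blast
qed

section \<open>The cost of an exchange\<close>

definition edges_cost :: "('a \<times> 'a) list \<Rightarrow> real" where
  "edges_cost rs = (\<Sum>x\<in>#mset (map edge_of rs). w x)"

definition links_cost :: "('a \<times> 'a) list \<Rightarrow> real" where
  "links_cost rs = (\<Sum>x\<in>#links rs. w x)"

text \<open>The link that bypasses \<open>e\<close> is no longer than the detour through its two old
  links and \<open>e\<close> itself. So the combined cost of links and removed edges never grows
  while edges are put back.\<close>

lemma cost_remove:
  assumes A: "A \<noteq> []" and rem: "removable rs"
    and rs: "mset (A @ [e]) = mset rs" "cyc_pairs (A @ [e]) = cyc_pairs rs"
  shows "links_cost A + edges_cost A \<le> links_cost rs + edges_cost rs"
proof -
  define p q where "p = last A" and "q = hd A"
  have pq: "p \<in> set A" "q \<in> set A" using A by (auto simp: p_def q_def)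
  have sub: "set rs = insert e (set A)" using mset_eq_setD[OF rs(1)] by auto
  have "distinct (A @ [e])" using removable_distinct[OF rem] mset_eq_imp_distinct_iff[OF rs(1)] by simp
  then have ne: "p \<noteq> e" "q \<noteq> e" using pq by auto
  have in_rs: "p \<in> set rs" "q \<in> set rs" "e \<in> set rs" using pq sub by auto
  then have o: "oriented p" "oriented q" "oriented e" using rem by (auto simp: removable_def)
  note eu = endpoint_unique[OF rem]
  \<comment> \<open>The triangle inequality is assumed for distinct vertices; the matching property
    supplies the distinctness.\<close>
  have d: "snd p \<noteq> fst e" "snd p \<noteq> snd e" "fst q \<noteq> fst e" "fst q \<noteq> snd e"
    using eu[OF in_rs(1,3)] eu[OF in_rs(2,3)] ne by auto
  have d2: "snd p \<noteq> fst q"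
    using eu[OF in_rs(1,2), of "snd p"] oriented_neq[OF o(1)] by auto
  have d3: "fst e \<noteq> snd e" using oriented_neq[OF o(3)] .
  note s = oriented_set[OF o(1)] oriented_set[OF o(2)] oriented_set[OF o(3)]
  have "w {snd p, fst q} \<le> w {snd p, fst e} + w {fst e, fst q}"
    using d d2 s by (intro tri) auto
  moreover have "w {fst e, fst q} \<le> w {fst e, snd e} + w {snd e, fst q}"
    using d d3 s by (intro tri) auto
  ultimately have t: "w {snd p, fst q} \<le> w {snd p, fst e} + w (edge_of e) + w {fst q, snd e}"
    by (simp add: insert_commute)
  have "links rs + {#{snd p, fst q}#} = links A + {#{snd p, fst e}, {fst q, snd e}#}"
    using links_snoc[OF A, of e] rs(2) by (simp add: links_def p_def q_def)
  from arg_cong[OF this, of "\<lambda>M. \<Sum>x\<in>#M. w x"]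
  have l: "links_cost rs + w {snd p, fst q} = links_cost A + w {snd p, fst e} + w {fst q, snd e}"
    by (simp add: links_cost_def add_ac)
  have "edges_cost rs = edges_cost (A @ [e])"
    unfolding edges_cost_def mset_map rs(1)[symmetric] ..
  then have "edges_cost rs = edges_cost A + w (edge_of e)" by (simp add: edges_cost_def)
  then show ?thesis using l t by simp
qed

text \<open>By \<open>size_cover_le\<close> the full exchange has at most \<open>h\<close>
  components. Putting back \<open>h - 1\<close> of the \<open>2 * h\<close> edges joins them into a
  single tour and leaves \<open>h + 1\<close> edges removed.\<close>

theorem exchange:
  assumes rem: "removable Z" and h: "length Z = 2 * h" "1 \<le> h"
    and cons: "\<And>e f. (e, f) \<in># cyc_pairs Z \<Longrightarrow> P (snd e) = P (fst f)"
    and types: "length (filter (\<lambda>e. P (fst e)) Z) \<le> h" "length (filter (\<lambda>e. \<not> P (fst e)) Z) \<le> h"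
  obtains ws rs where "mset ws = mset vs" "removable rs" "set rs \<subseteq> set Z" "length rs = Suc h"
    "cyc_edges ws + mset (map edge_of rs) = cyc_edges vs + links rs"
    "links_cost rs + edges_cost rs \<le> links_cost Z + edges_cost Z"
proof -
  \<comment> \<open>Here \<open>i\<close> counts the edges put back. The maximum with 1 allows for a
    single tour being reached early; from then on reversals keep it single.\<close>
  have "\<exists>rs F. state rs F \<and> set rs \<subseteq> set Z \<and> length rs = 2 * h - i \<and> size F \<le> max 1 (h - i) \<and>
      links_cost rs + edges_cost rs \<le> links_cost Z + edges_cost Z" if "i \<le> h - 1" for i
    using that
  proof (induction i)
    case 0
    obtain F where F: "state Z F" using ex_state[OF rem] by blast
    then have "2 * size F \<le> 2 * h" using size_cover_le[OF F cons] h by simp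
    then show ?case using F h by (intro exI[of _ Z] exI[of _ F]) auto
  next
    case (Suc i)
    then obtain rs F where st: "state rs F" and rs: "set rs \<subseteq> set Z" "length rs = 2 * h - i"
      and F: "size F \<le> max 1 (h - i)" and c: "links_cost rs + edges_cost rs \<le> links_cost Z + edges_cost Z"
      by auto
    have remr: "removable rs" using st by (simp add: state_def)
    have l2: "2 \<le> length rs" "h < length rs" using rs(2) Suc.prems by auto
    have fin: ?case if "A \<noteq> []" "mset (A @ [e]) = mset rs" "cyc_pairs (A @ [e]) = cyc_pairs rs"
      "state A F'" "size F' \<le> max 1 (h - Suc i)" for A e F'
    proof -
      have "length A = length rs - 1" using mset_eq_length[OF that(2)] by simp
      moreover have "set A \<subseteq> set Z" using mset_eq_setD[OF that(2)] rs(1) by auto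
      ultimately show ?thesis using that cost_remove[OF that(1) remr that(2,3)] c rs(2)
        by (intro exI[of _ A] exI[of _ F']) auto
    qed
    show ?case
    proof (cases "2 \<le> size F")
      case True
      then obtain A e F' where "A \<noteq> []" "mset (A @ [e]) = mset rs" "cyc_pairs (A @ [e]) = cyc_pairs rs"
        "state A F'" "size F = Suc (size F')" using merge_step[OF st _ l2(1)] by blast
      then show ?thesis using fin F by auto
    next
      case False
      moreover have "F \<noteq> {#}" using st len by (auto simp: state_def cover_def)
      ultimately have "size F = 1" by (simp add: nonempty_has_size)
      then obtain us where us: "F = {#us#}" using size_1_singleton_mset by blast
      \<comment> \<open>More than \<open>h\<close> edges are still removed and each type occurs at
        most \<open>h\<close> times in \<open>Z\<close>, so both types remain.\<close>
      have ex: "\<exists>e\<in>set rs. Q e" if "length (filter (\<lambda>e. \<not> Q e) Z) \<le> h" for Q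
      proof (rule ccontr)
        assume "\<not> ?thesis"
        then have "set rs \<subseteq> set (filter (\<lambda>e. \<not> Q e) Z)" using rs(1) by auto
        then have "card (set rs) \<le> length (filter (\<lambda>e. \<not> Q e) Z)"
          by (meson List.finite_set card_length card_mono order_trans)
        then show False using distinct_card[OF removable_distinct[OF remr]] that l2(2) by simp
      qed
      obtain e1 e2 where "e1 \<in> set rs" "P (fst e1)" "e2 \<in> set rs" "\<not> P (fst e2)"
        using ex[of "\<lambda>e. P (fst e)"] ex[of "\<lambda>e. \<not> P (fst e)"] types by auto
      then obtain A e zs where "A \<noteq> []" "mset (A @ [e]) = mset rs" "cyc_pairs (A @ [e]) = cyc_pairs rs"
        "state A {#zs#}" using reverse_step[OF st[unfolded us] l2(1)] by blast
      then show ?thesis using fin[of A e "{#zs#}"] by auto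
    qed
  qed
  from this[of "h - 1"] obtain rs F where st: "state rs F" and rs: "set rs \<subseteq> set Z" "length rs = 2 * h - (h - 1)"
      and F: "size F \<le> max 1 (h - (h - 1))" and c: "links_cost rs + edges_cost rs \<le> links_cost Z + edges_cost Z"
    by auto
  have "F \<noteq> {#}" using st len by (auto simp: state_def cover_def)
  then have "size F = 1" using F h(2) by (simp add: nonempty_has_size)
  then obtain ws where ws: "F = {#ws#}" using size_1_singleton_mset by blast
  show ?thesis
    by (rule that[of ws rs]) (use st rs c h ws in \<open>auto simp: state_def cover_def\<close>)
qed

end

section \<open>Short closed walks of long edges\<close>

lemma tour_cost_cyc_edges:
  assumes "distinct xs" "3 \<le> length xs"
  shows "tour_cost w (set_mset (cyc_edges xs)) = (\<Sum>x\<in>#cyc_edges xs. w x)"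
  unfolding tour_cost_def sum_unfold_sum_mset distinct_cyc_edges[OF assms, symmetric] ..

text \<open>The cyclic successor permutes the positions and interchanges those with \<open>Q\<close>
  and those without.\<close>

lemma alternating_balanced:
  assumes "\<And>e f. (e, f) \<in># cyc_pairs Z \<Longrightarrow> Q f \<longleftrightarrow> \<not> Q e"
  shows "length (filter Q Z) = length (filter (\<lambda>e. \<not> Q e) Z)"
proof -
  have "length (filter Q Z) = size (filter_mset Q (image_mset snd (cyc_pairs Z)))"
    unfolding image_snd_cyc_pairs by (metis mset_filter size_mset)
  also have "\<dots> = size (filter_mset (\<lambda>p. Q (snd p)) (cyc_pairs Z))"
    by (simp add: filter_mset_image_mset comp_def)
  also have "filter_mset (\<lambda>p. Q (snd p)) (cyc_pairs Z) = filter_mset (\<lambda>p. \<not> Q (fst p)) (cyc_pairs Z)"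
    using assms by (intro filter_mset_cong) (auto simp: prod_eq_iff)
  also have "size \<dots> = size (filter_mset (\<lambda>e. \<not> Q e) (image_mset fst (cyc_pairs Z)))"
    by (simp add: filter_mset_image_mset comp_def)
  also have "\<dots> = length (filter (\<lambda>e. \<not> Q e) Z)"
    unfolding image_fst_cyc_pairs by (metis mset_filter size_mset)
  finally show ?thesis .
qed

text \<open>The bound \<open>3 * real k * eps \<le> 2\<close> makes the gain positive: with \<open>2 * h\<close> edges in the walk,
  \<open>h + 1\<close> edges longer than \<open>L\<close> are traded for links that cost at most
  \<open>(h - 1) * (1 + eps) * L + 2 * h * eps * L\<close>.\<close>

lemma no_improving_closed_walk:
  fixes w :: "nat set \<Rightarrow> real" and eps L :: real
  assumes metric: "metric_instance n w"
    and opt: "k_optimal k n w (set_mset (cyc_edges vs))"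
    and vs: "distinct vs" "set vs = {..<n}" and n: "3 \<le> n"
    and seg: "\<And>x y. x < n \<Longrightarrow> y < n \<Longrightarrow> x \<noteq> y \<Longrightarrow> seg x = seg y \<Longrightarrow> w {x, y} \<le> eps * L"
    and L: "0 \<le> L" and eps: "0 \<le> eps" "3 * real k * eps \<le> 2"
    and Z: "Z \<noteq> []" "length Z < 2 * k" "distinct (map edge_of Z)"
    and edges: "\<And>e. e \<in> set Z \<Longrightarrow> tour_exchange.oriented vs P e \<and>
      L < w (edge_of e) \<and> w (edge_of e) \<le> (1 + eps) * L"
    and P: "\<And>x. P x \<longleftrightarrow> seg x \<in> A"
    and walk: "\<And>e f. (e, f) \<in># cyc_pairs Z \<Longrightarrow> seg (snd e) = seg (fst f)"
  shows False
proof -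
  have len: "length vs = n" using vs by (metis card_lessThan distinct_card)
  interpret tour_exchange vs P w
  proof
    show "distinct vs" "3 \<le> length vs" using vs n len by auto
    fix x y z assume "x \<in> set vs" "y \<in> set vs" "z \<in> set vs" "x \<noteq> y" "y \<noteq> z" "x \<noteq> z"
    then show "w {x, y} \<le> w {x, z} + w {z, y}"
      using metric unfolding metric_instance_def vs(2) by simp
  qed
  have rem: "removable Z" using Z edges by (auto simp: removable_def)
  \<comment> \<open>Membership in \<open>P\<close> depends only on the cluster, and consecutive
    edges of the walk meet in a cluster. Hence the walk alternates between edges along and against
    the tour, and its length is even.\<close>
  have cons: "P (snd e) = P (fst f)" if "(e, f) \<in># cyc_pairs Z" for e f
    using walk[OF that] by (simp add: P)
  have alt: "P (fst f) \<longleftrightarrow> \<not> P (fst e)" if ef: "(e, f) \<in># cyc_pairs Z" for e f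
    using cons[OF ef] oriented_P[of e] edges[of e] cyc_pairs_mem_set[OF ef] by auto
  define h where "h = length (filter (\<lambda>e. P (fst e)) Z)"
  have h': "length (filter (\<lambda>e. \<not> P (fst e)) Z) = h"
    unfolding h_def using alternating_balanced[of Z "\<lambda>e. P (fst e)"] alt by simp
  have hZ: "length Z = 2 * h"
    using sum_length_filter_compl[of "\<lambda>e. P (fst e)" Z] h' h_def by simp
  have h1: "1 \<le> h" using hZ Z(1) by (cases h) auto
  have hk: "Suc h \<le> k" using hZ Z(2) by simp
  obtain ws rs where ws: "mset ws = mset vs" and rem_rs: "removable rs" and rs: "set rs \<subseteq> set Z" "length rs = Suc h"
    and eq: "cyc_edges ws + mset (map edge_of rs) = cyc_edges vs + links rs"
    and cost: "links_cost rs + edges_cost rs \<le> links_cost Z + edges_cost Z"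
    by (rule exchange[OF rem hZ h1 cons]) (simp_all add: h' flip: h_def)
  have dws: "distinct ws" "set ws = {..<n}" "3 \<le> length ws"
    using mset_eq_imp_distinct_iff[OF ws] mset_eq_setD[OF ws] mset_eq_length[OF ws] vs n len by auto
  define T' where "T' = set_mset (cyc_edges ws)"
  have tours: "is_tour n T'" "is_tour n (set_mset (cyc_edges vs))"
    using n dws vs unfolding is_tour_iff T'_def by blast+
  \<comment> \<open>Every edge missing from the new tour is among the \<open>h + 1\<close> edges of
    \<open>rs\<close>, so this is a \<open>k\<close>-move.\<close>
  have "set_mset (cyc_edges vs) - T' \<subseteq> edge_of ` set rs"
  proof
    fix x assume x: "x \<in> set_mset (cyc_edges vs) - T'"
    then have "x \<in># cyc_edges vs + links rs" by simp
    then have "x \<in># cyc_edges ws + mset (map edge_of rs)" unfolding eq .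
    then show "x \<in> edge_of ` set rs" using x by (auto simp: T'_def)
  qed
  then have "card (set_mset (cyc_edges vs) - T') \<le> card (set rs)"
    by (rule surj_card_le[rotated]) simp
  also have "\<dots> \<le> k" using card_length[of rs] rs(2) hk by simp
  finally have move: "k_move k n (set_mset (cyc_edges vs)) T'"
    using tours by (simp add: k_move_def)
  have drs: "distinct rs" and dZ: "distinct Z" using rem_rs rem by (auto dest: removable_distinct)
  have ec: "edges_cost xs = (\<Sum>e\<in>set xs. w (edge_of e))" if "distinct xs" for xs
    using that by (simp add: edges_cost_def sum_unfold_sum_mset mset_set_set multiset.map_comp comp_def)
  have cd: "card (set rs) = Suc h" "card (set Z - set rs) = h - 1"
    using distinct_card[OF drs] distinct_card[OF dZ] rs hZ by (auto simp: card_Diff_subset)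
  have "edges_cost Z = edges_cost rs + (\<Sum>e\<in>set Z - set rs. w (edge_of e))"
    unfolding ec[OF drs] ec[OF dZ] by (subst sum.subset_diff[OF rs(1)]) simp_all
  also have "(\<Sum>e\<in>set Z - set rs. w (edge_of e)) \<le> (\<Sum>e\<in>set Z - set rs. (1 + eps) * L)"
    using edges by (intro sum_mono) auto
  also have "\<dots> = (real h - 1) * (1 + eps) * L"
    using cd(2) h1 by (simp add: of_nat_diff)
  finally have c1: "edges_cost Z \<le> edges_cost rs + (real h - 1) * (1 + eps) * L" by simp
  have "(\<Sum>e\<in>set rs. L) < edges_cost rs"
    unfolding ec[OF drs] using edges rs cd(1) by (intro sum_strict_mono) auto
  then have c2: "(real h + 1) * L < edges_cost rs" using cd(1) by (simp add: add.commute)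
  have "links_cost Z \<le> (\<Sum>x\<in>#links Z. eps * L)"
    unfolding links_cost_def
  proof (rule sum_mset_mono)
    fix x assume "x \<in># links Z"
    then obtain e f where ef: "(e, f) \<in># cyc_pairs Z" "x = {snd e, fst f}"
      by (auto simp: links_def)
    have efZ: "e \<in> set Z" "f \<in> set Z" using cyc_pairs_mem_set[OF ef(1)] by auto
    then have o: "oriented e" "oriented f" using edges by auto
    have "snd e \<noteq> fst f"
    proof
      assume *: "snd e = fst f"
      then have "e = f" using endpoint_unique[OF rem efZ, of "snd e"] by simp
      then show False using * oriented_neq[OF o(1)] by simp
    qed
    moreover have "snd e < n" "fst f < n" using oriented_set[OF o(1)] oriented_set[OF o(2)] vs(2) by auto
    ultimately show "w x \<le> eps * L" using seg walk[OF ef(1)] ef(2) by simp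
  qed
  also have "\<dots> = 2 * real h * (eps * L)"
    using hZ by (simp add: links_def cyc_pairs_def)
  finally have c3: "links_cost Z \<le> 2 * real h * (eps * L)" .
  \<comment> \<open>After inserting the three bounds it suffices that
    \<open>(3 * h - 1) * eps \<le> 2\<close>.\<close>
  have "(3 * real h) * eps \<le> (3 * real k) * eps"
    using hk eps(1) by (intro mult_right_mono) auto
  then have "(3 * real h) * eps * L \<le> 2 * L"
    using eps(2) L by (intro mult_right_mono) auto
  moreover have "0 \<le> eps * L" using eps L by simp
  ultimately have "links_cost Z + edges_cost Z < 2 * edges_cost rs"
    using c1 c2 c3 by (simp add: algebra_simps)
  \<comment> \<open>The length changes by \<open>links_cost rs - edges_cost rs\<close>, which is
    negative because the sum of these two costs is below \<open>2 * edges_cost rs\<close>.\<close>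
  moreover have "tour_cost w T' + edges_cost rs = tour_cost w (set_mset (cyc_edges vs)) + links_cost rs"
    using arg_cong[OF eq, of "\<lambda>M. \<Sum>x\<in>#M. w x"] tour_cost_cyc_edges[OF dws(1,3)]
      tour_cost_cyc_edges[of vs w] vs(1) len n
    by (simp add: T'_def edges_cost_def links_cost_def)
  ultimately have "tour_cost w T' < tour_cost w (set_mset (cyc_edges vs))" using cost by simp
  then show False using opt move unfolding k_optimal_def by blast
qed

section \<open>A large directed cut\<close>

text \<open>A uniformly random subset contains \<open>a\<close> and misses \<open>b\<close> with
  probability one quarter: only the membership of the other elements is free.\<close>

lemma card_separating_subsets:
  assumes "finite S" "a \<in> S" "b \<in> S" "a \<noteq> b"
  shows "4 * card {A \<in> Pow S. a \<in> A \<and> b \<notin> A} = 2 ^ card S"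
proof -
  have "{A \<in> Pow S. a \<in> A \<and> b \<notin> A} = insert a ` Pow (S - {a, b})"
  proof (intro equalityI subsetI)
    fix A assume A: "A \<in> {A \<in> Pow S. a \<in> A \<and> b \<notin> A}"
    then have "A = insert a (A - {a})" "A - {a} \<in> Pow (S - {a, b})" by auto
    then show "A \<in> insert a ` Pow (S - {a, b})" by blast
  qed (use assms in auto)
  moreover have "inj_on (insert a) (Pow (S - {a, b}))" by (auto simp: inj_on_def insert_ident)
  ultimately have "card {A \<in> Pow S. a \<in> A \<and> b \<notin> A} = 2 ^ card (S - {a, b})"
    using assms(1) by (simp add: card_image card_Pow)
  moreover have "card S = Suc (Suc (card (S - {a, b})))"
    using assms by (metis card_Suc_Diff1 finite_Diff insertE Diff_insert2 insert_Diff insert_iff)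
  ultimately show ?thesis by simp
qed

text \<open>Average over all subsets of \<open>S\<close>: each edge crosses in the wanted direction
  for a quarter of them, so double counting refutes that every cut has too few edges.\<close>

lemma ex_large_directed_cut:
  assumes "finite E" "finite S" "\<And>e. e \<in> E \<Longrightarrow> s e \<in> S \<and> t e \<in> S \<and> s e \<noteq> t e"
  shows "\<exists>A\<subseteq>S. card E \<le> 4 * card {e \<in> E. s e \<in> A \<and> t e \<notin> A}"
proof (rule ccontr)
  assume "\<not> ?thesis"
  then have "(\<Sum>A\<in>Pow S. 4 * card {e \<in> E. s e \<in> A \<and> t e \<notin> A}) < (\<Sum>A\<in>Pow S. card E)"
    using assms(2) by (intro sum_strict_mono) (auto simp: not_le)
  also have "\<dots> = card E * 2 ^ card S" using assms(2) by (simp add: card_Pow)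
  also have "\<dots> = (\<Sum>e\<in>E. 4 * card {A \<in> Pow S. s e \<in> A \<and> t e \<notin> A})"
    using card_separating_subsets[OF assms(2)] assms(3) by simp
  also have "\<dots> = (\<Sum>A\<in>Pow S. 4 * card {e \<in> E. s e \<in> A \<and> t e \<notin> A})"
    unfolding sum_distrib_left[symmetric]
    using sum.swap_restrict[OF assms(1) finite_Pow_iff[THEN iffD2, OF assms(2)],
        of "\<lambda>_ _. 1::nat" "\<lambda>e A. s e \<in> A \<and> t e \<notin> A"] by simp
  finally show False by simp
qed

lemma card_le_ex:
  assumes "simple_graph m G" "\<And>N. has_cycle G N \<Longrightarrow> g \<le> N"
  shows "card G \<le> ex m g"
proof -
  have "{card E | E. simple_graph m E \<and> enat g \<le> girth E} \<subseteq> card ` Pow (Pow {..<m})"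
    by (auto simp: simple_graph_def)
  then have "finite {card E | E. simple_graph m E \<and> enat g \<le> girth E}"
    by (rule finite_subset) simp
  moreover have "enat g \<le> girth G" using assms(2) by (auto simp: girth_def le_INF_iff)
  ultimately show ?thesis unfolding ex_def using assms(1) by (intro Max_ge) auto
qed

section \<open>Clusters along a tour\<close>

lemma tour_cost_nth:
  assumes "distinct xs" "3 \<le> length xs"
  shows "tour_cost w (set_mset (cyc_edges xs)) = (\<Sum>i<length xs. w {xs ! i, xs ! (Suc i mod length xs)})"
proof -
  have "(\<Sum>x\<in>#cyc_edges xs. w x) = sum_list (map (\<lambda>(x, y). w {x, y}) (zip xs (rotate1 xs)))"
    by (simp add: cyc_edges_def cyc_pairs_def multiset.map_comp comp_def case_prod_unfold sum_mset_sum_list flip: mset_map)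
  also have "\<dots> = (\<Sum>i<length xs. w {xs ! i, xs ! (Suc i mod length xs)})"
    by (simp add: sum_list_sum_nth nth_rotate1 atLeast0LessThan)
  finally show ?thesis using tour_cost_cyc_edges[OF assms] by simp
qed

text \<open>The tour is cut by distance from its first vertex, since the length of a path along the
  tour bounds the distance of its ends. The last bound later excludes length classes above the
  optimum.\<close>

lemma ex_clustering:
  fixes w :: "nat set \<Rightarrow> real" and \<delta> :: real
  assumes metric: "metric_instance n w" and tour: "is_tour n T" and \<delta>: "0 < \<delta>"
  obtains seg :: "nat \<Rightarrow> nat" and m where "\<And>x. x < n \<Longrightarrow> seg x < m"
    "0 < m" "real m \<le> tour_cost w T / \<delta> + 1"
    "\<And>x y. x < n \<Longrightarrow> y < n \<Longrightarrow> x \<noteq> y \<Longrightarrow> seg x = seg y \<Longrightarrow> w {x, y} \<le> \<delta>"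
    "\<And>x y. x < n \<Longrightarrow> y < n \<Longrightarrow> x \<noteq> y \<Longrightarrow> w {x, y} \<le> tour_cost w T"
proof -
  obtain xs where n: "3 \<le> n" and xs: "distinct xs" "set xs = {..<n}" and T: "T = set_mset (cyc_edges xs)"
    using tour unfolding is_tour_iff by blast
  have len: "length xs = n" using xs by (metis card_lessThan distinct_card)
  have lt: "xs ! i < n" if "i < n" for i
    using that xs(2) len nth_mem by blast
  have neq: "xs ! i \<noteq> xs ! j" if "i < n" "j < n" "i \<noteq> j" for i j
    using that xs(1) len by (simp add: nth_eq_iff_index_eq)
  \<comment> \<open>This is the length of the tour path from \<open>xs ! 0\<close> to
    \<open>xs ! i\<close>, so the closing edge never enters.\<close>
  define pos where "pos i = (\<Sum>j<i. w {xs ! j, xs ! Suc j})" for i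
  have nonneg: "0 \<le> w {xs ! i, xs ! j}" if "i < n" "j < n" "i \<noteq> j" for i j
    using metric lt[OF that(1)] lt[OF that(2)] neq[OF that] unfolding metric_instance_def by simp
  have pos0: "0 \<le> pos i" if "i < n" for i
    unfolding pos_def using that by (intro sum_nonneg nonneg) auto
  have posW: "pos i \<le> tour_cost w T" if "i < n" for i
  proof -
    have "pos i = (\<Sum>j<i. w {xs ! j, xs ! (Suc j mod n)})"
      unfolding pos_def using that by (intro sum.cong) auto
    also have "\<dots> \<le> (\<Sum>j<n. w {xs ! j, xs ! (Suc j mod n)})"
    proof (rule sum_mono2)
      fix j assume "j \<in> {..<n} - {..<i}"
      then show "0 \<le> w {xs ! j, xs ! (Suc j mod n)}"
        using n by (intro nonneg) (auto simp: mod_Suc)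
    qed (use that in auto)
    finally show ?thesis using tour_cost_nth[OF xs(1)] n len T by simp
  qed
  have dist: "w {xs ! i, xs ! j} \<le> pos j - pos i" if "i < j" "j < n" for i j
    using that
  proof (induction j)
    case (Suc j)
    show ?case
    proof (cases "i = j")
      case False
      then have "w {xs ! i, xs ! Suc j} \<le> w {xs ! i, xs ! j} + w {xs ! j, xs ! Suc j}"
        using metric Suc.prems lt[of i] lt[of j] lt[of "Suc j"] neq[of i j] neq[of j "Suc j"] neq[of i "Suc j"]
        unfolding metric_instance_def by simp
      then show ?thesis using Suc False by (simp add: pos_def)
    qed (simp add: pos_def)
  qed simp
  have dist': "w {xs ! i, xs ! j} \<le> \<bar>pos j - pos i\<bar>" if "i < n" "j < n" "i \<noteq> j" for i j
    using dist[of i j] dist[of j i] that by (cases "i < j") (auto simp: insert_commute)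
  define ix where "ix x = (THE i. i < n \<and> xs ! i = x)" for x
  have ix: "ix x < n" "xs ! ix x = x" if "x < n" for x
  proof -
    obtain i where i: "i < n" "xs ! i = x"
      using \<open>x < n\<close> xs(2) len by (metis in_set_conv_nth lessThan_iff)
    have "ix x = i"
      unfolding ix_def by (rule the_equality) (use i neq in \<open>simp, metis\<close>)
    then show "ix x < n" "xs ! ix x = x" using i by auto
  qed
  \<comment> \<open>Positions are rounded down to multiples of \<open>\<delta>\<close>. The indices
    start at 0, hence the summand 1 in \<open>m\<close>.\<close>
  define seg where "seg x = nat \<lfloor>pos (ix x) / \<delta>\<rfloor>" for x
  define m where "m = nat \<lfloor>tour_cost w T / \<delta>\<rfloor> + 1"
  have W: "0 \<le> tour_cost w T" using posW[of 0] pos0[of 0] n by simp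
  show ?thesis
  proof (rule that[of seg m])
    show "seg x < m" if "x < n" for x
      unfolding seg_def m_def using posW[OF ix(1)[OF that]] \<delta>
      by (simp add: less_Suc_eq_le nat_mono floor_mono divide_right_mono)
    show "0 < m" by (simp add: m_def)
    show "real m \<le> tour_cost w T / \<delta> + 1"
      using W \<delta> by (simp add: m_def)
    fix x y assume xy: "x < n" "y < n" "x \<noteq> y"
    have d: "w {x, y} \<le> \<bar>pos (ix y) - pos (ix x)\<bar>"
      using dist'[OF ix(1)[OF xy(1)] ix(1)[OF xy(2)]] ix(2) xy by metis
    show "w {x, y} \<le> tour_cost w T"
      using d posW[OF ix(1)[OF xy(1)]] posW[OF ix(1)[OF xy(2)]]
        pos0[OF ix(1)[OF xy(1)]] pos0[OF ix(1)[OF xy(2)]] by linarith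
    assume "seg x = seg y"
    moreover have "0 \<le> pos (ix x) / \<delta>" "0 \<le> pos (ix y) / \<delta>"
      using pos0 ix(1) xy \<delta> by simp_all
    ultimately have "\<lfloor>pos (ix x) / \<delta>\<rfloor> = \<lfloor>pos (ix y) / \<delta>\<rfloor>"
      using eq_nat_nat_iff zero_le_floor by (simp add: seg_def)
    then have "\<bar>pos (ix y) / \<delta> - pos (ix x) / \<delta>\<bar> < 1" by linarith
    then have "\<bar>pos (ix y) - pos (ix x)\<bar> / \<delta> < 1"
      using \<delta> by (simp flip: diff_divide_distrib)
    then show "w {x, y} \<le> \<delta>" using d \<delta> by (simp add: field_simps)
  qed
qed

lemma distinct_if_mset_eq_mset_set:
  assumes "mset xs = mset_set B" "finite B"
  shows "distinct xs"
proof -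
  obtain ys where "distinct ys" "set ys = B" using finite_distinct_list[OF assms(2)] by blast
  then have "mset xs = mset ys" using assms(1) by (simp add: mset_set_set[symmetric])
  then show ?thesis using \<open>distinct ys\<close> mset_eq_imp_distinct_iff by blast
qed

section \<open>The number of edges in one length class\<close>

text \<open>Contracting clusters turns the edges across a directed cut into a graph of girth at
  least \<open>2 * k\<close>, as a shorter cycle lifts to a walk excluded by
  \<open>no_improving_closed_walk\<close>. The factor 4 is the loss from passing to the cut.\<close>

lemma card_length_class_le_ex:
  fixes w :: "nat set \<Rightarrow> real" and eps L :: real
  assumes metric: "metric_instance n w"
    and opt: "k_optimal k n w (set_mset (cyc_edges vs))"
    and vs: "distinct vs" "set vs = {..<n}" and n: "3 \<le> n" and k: "2 \<le> k"
    and seg: "\<And>x y. x < n \<Longrightarrow> y < n \<Longrightarrow> x \<noteq> y \<Longrightarrow> seg x = seg y \<Longrightarrow> w {x, y} \<le> eps * L"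
    and segm: "\<And>x. x < n \<Longrightarrow> seg x < m"
    and L: "0 \<le> L" and eps: "0 \<le> eps" "eps \<le> 1" "3 * real k * eps \<le> 2"
  shows "card {e \<in> set_mset (cyc_pairs vs). L < w (edge_of e) \<and> w (edge_of e) \<le> (1 + eps) * L} \<le> 4 * ex m (2 * k)"
proof -
  define E where "E = {e \<in> set_mset (cyc_pairs vs). L < w (edge_of e) \<and> w (edge_of e) \<le> (1 + eps) * L}"
  have len: "length vs = n" using vs by (metis card_lessThan distinct_card)
  have finE: "finite E" by (simp add: E_def)
  have Ev: "fst e < n" "snd e < n" "fst e \<noteq> snd e" if "e \<in> E" for e
    using that cyc_pairs_mem_set[of "fst e" "snd e" vs] vs(2)
      cyc_pairs_asym(2)[OF vs(1), of "fst e" "snd e"] n len by (auto simp: E_def)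
  \<comment> \<open>An edge inside a cluster has length at most \<open>eps * L \<le> L\<close>, too
    short for this class.\<close>
  have segE: "seg (fst e) \<noteq> seg (snd e)" if e: "e \<in> E" for e
  proof
    assume "seg (fst e) = seg (snd e)"
    from seg[OF Ev[OF e] this] have "w (edge_of e) \<le> eps * L" .
    also have "\<dots> \<le> 1 * L" using L eps by (intro mult_right_mono)
    finally show False using e by (simp add: E_def)
  qed
  obtain A where cut: "card E \<le> 4 * card {e \<in> E. seg (fst e) \<in> A \<and> seg (snd e) \<notin> A}"
    using ex_large_directed_cut[of E "{..<m}" "\<lambda>e. seg (fst e)" "\<lambda>e. seg (snd e)"]
      finE Ev segE segm by blast
  define E' where "E' = {e \<in> E. seg (fst e) \<in> A \<and> seg (snd e) \<notin> A}"
  define P where "P x \<longleftrightarrow> seg x \<in> A" for x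
  interpret tour_exchange vs P w
  proof
    show "distinct vs" "3 \<le> length vs" using vs n len by auto
    fix x y z assume "x \<in> set vs" "y \<in> set vs" "z \<in> set vs" "x \<noteq> y" "y \<noteq> z" "x \<noteq> z"
    then show "w {x, y} \<le> w {x, z} + w {z, y}"
      using metric unfolding metric_instance_def vs(2) by simp
  qed
  have ori: "oriented e \<and> L < w (edge_of e) \<and> w (edge_of e) \<le> (1 + eps) * L"
    if "e \<in> E' \<or> prod.swap e \<in> E'" for e
    using that by (cases e) (auto simp: E'_def E_def oriented_def P_def insert_commute)
  have no_walk: False
    if "Z \<noteq> []" "length Z < 2 * k" "distinct (map edge_of Z)"
      "\<And>e. e \<in> set Z \<Longrightarrow> e \<in> E' \<or> prod.swap e \<in> E'"
      "\<And>e f. (e, f) \<in># cyc_pairs Z \<Longrightarrow> seg (snd e) = seg (fst f)" for Z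
    by (rule no_improving_closed_walk[OF metric opt vs n seg L eps(1,3) that(1-3) ori[OF that(4)] P_def that(5)])
  define cl where "cl e = {seg (fst e), seg (snd e)}" for e :: "nat \<times> nat"
  \<comment> \<open>All crossing edges leave \<open>A\<close>, so two of them with the same clusters
    are parallel. Traversing one forward and the other backward gives a closed walk with two
    edges.\<close>
  have inj: "inj_on cl E'"
  proof (rule inj_onI, rule ccontr)
    fix e f assume ef: "e \<in> E'" "f \<in> E'" "cl e = cl f" "e \<noteq> f"
    have s: "seg (fst e) = seg (fst f)" "seg (snd e) = seg (snd f)"
      using ef(1-3) unfolding cl_def E'_def by (auto simp: doubleton_eq_iff)
    have "edge_of e \<noteq> edge_of f"
      using ef(1,2,4) s segE[of e] unfolding E'_def
      by (auto simp: doubleton_eq_iff prod_eq_iff)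
    then show False
      using ef(1,2) s k
      by (intro no_walk[of "[e, prod.swap f]"]) (auto simp: cyc_pairs_def insert_commute)
  qed
  have simple: "simple_graph m (cl ` E')"
  proof -
    have "cl e \<subseteq> {..<m} \<and> card (cl e) = 2" if "e \<in> E'" for e
      using that segE[of e] Ev[of e] segm unfolding cl_def E'_def by auto
    then show ?thesis by (auto simp: simple_graph_def)
  qed
  have girth: "2 * k \<le> N" if "has_cycle (cl ` E') N" for N
  proof (rule ccontr)
    assume short: "\<not> 2 * k \<le> N"
    obtain cs where N: "3 \<le> N" "length cs = N" and cs: "distinct cs"
      "\<forall>i<N. {cs ! i, cs ! (Suc i mod N)} \<in> cl ` E'"
      using \<open>has_cycle (cl ` E') N\<close> unfolding has_cycle_def by blast
    \<comment> \<open>Each edge of the cycle lifts to a tour edge directed along the cycle.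
      Consecutive lifted edges share a cluster, though not necessarily a vertex.\<close>
    have "\<forall>i. \<exists>e. i < N \<longrightarrow> seg (fst e) = cs ! i \<and> seg (snd e) = cs ! (Suc i mod N) \<and>
        (e \<in> E' \<or> prod.swap e \<in> E')"
    proof (intro allI)
      fix i
      show "\<exists>e. i < N \<longrightarrow> seg (fst e) = cs ! i \<and> seg (snd e) = cs ! (Suc i mod N) \<and>
        (e \<in> E' \<or> prod.swap e \<in> E')"
      proof (cases "i < N")
        case True
        then obtain u v where uv: "(u, v) \<in> E'" "{cs ! i, cs ! (Suc i mod N)} = cl (u, v)"
          using cs(2) by fastforce
        show ?thesis
        proof (cases "cs ! i = seg u")
          case True
          then show ?thesis using uv by (intro exI[of _ "(u, v)"]) (auto simp: cl_def doubleton_eq_iff)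
        next
          case False
          then show ?thesis using uv by (intro exI[of _ "(v, u)"]) (auto simp: cl_def doubleton_eq_iff)
        qed
      qed auto
    qed
    then obtain z where z: "\<And>i. i < N \<Longrightarrow> seg (fst (z i)) = cs ! i"
      "\<And>i. i < N \<Longrightarrow> seg (snd (z i)) = cs ! (Suc i mod N)"
      "\<And>i. i < N \<Longrightarrow> z i \<in> E' \<or> prod.swap (z i) \<in> E'"
      by metis
    define Z where "Z = map z [0..<N]"
    have lenZ: "length Z = N" by (simp add: Z_def)
    \<comment> \<open>The lifted edges are distinct because their images are: a cycle on at least
      three clusters repeats no edge.\<close>
    have "mset (map (\<lambda>x. seg ` x) (map edge_of Z)) = cyc_edges cs"
    proof -
      have "map (\<lambda>x. seg ` x) (map edge_of Z) = map (\<lambda>(x, y). {x, y}) (zip cs (rotate1 cs))"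
        using N z by (intro nth_equalityI) (auto simp: Z_def nth_rotate1)
      then show ?thesis by (simp add: cyc_edges_def cyc_pairs_def flip: mset_map)
    qed
    also have "\<dots> = mset_set (set_mset (cyc_edges cs))"
      using cs(1) N by (intro distinct_cyc_edges) auto
    finally have "distinct (map (\<lambda>x. seg ` x) (map edge_of Z))"
      by (rule distinct_if_mset_eq_mset_set) simp
    then have dZ: "distinct (map edge_of Z)" unfolding distinct_map[of _ "map edge_of Z"] by blast
    show False
    proof (rule no_walk[of Z])
      show "Z \<noteq> []" "length Z < 2 * k" "distinct (map edge_of Z)"
        using lenZ N short dZ by auto
      show "e \<in> E' \<or> prod.swap e \<in> E'" if "e \<in> set Z" for e
      proof -
        obtain i where "i < N" "e = z i" using \<open>e \<in> set Z\<close> by (auto simp: Z_def)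
        then show ?thesis using z(3) by blast
      qed
      fix e f assume "(e, f) \<in># cyc_pairs Z"
      then obtain i where i: "i < N" "e = z i" "f = z (Suc i mod N)"
        unfolding cyc_pairs_nth lenZ using N(1) by (auto simp: Z_def)
      have "Suc i mod N < N" using N(1) by (intro mod_less_divisor) auto
      then show "seg (snd e) = seg (fst f)" using z(1,2) i by simp
    qed
  qed
  have "card E' = card (cl ` E')" using inj by (simp add: card_image)
  also have "\<dots> \<le> ex m (2 * k)" using simple girth by (rule card_le_ex)
  finally show ?thesis using cut unfolding E'_def E_def by simp
qed

section \<open>Summation over geometric length classes\<close>

text \<open>Values up to \<open>L0\<close> sum to at most \<open>n * L0\<close>, which is
  \<open>n powr (1 - 1 / c) * W\<close>. The class that starts at \<open>L0 * q ^ i\<close> sums to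
  at most \<open>q * K * r ^ i\<close> times the same quantity, and the series in
  \<open>r = q powr (1 - c) < 1\<close> converges.\<close>

lemma sum_geometric_classes:
  fixes f :: "'b \<Rightarrow> real" and W K q c :: real
  assumes fin: "finite S" and S: "card S \<le> n" "0 < n" and pos: "0 < W" "0 \<le> K" and q: "1 < q" and c: "1 < c"
    and cls: "\<And>L. 0 < L \<Longrightarrow> real (card {s \<in> S. L < f s \<and> f s \<le> q * L}) \<le> K * (W / L) powr c"
  shows "sum f S \<le> (1 + q * K / (1 - q powr (1 - c))) * real n powr (1 - 1 / c) * W"
proof -
  define L0 where "L0 = W * real n powr (- 1 / c)"
  define r where "r = q powr (1 - c)"
  have L0: "0 < L0" using pos(1) S(2) by (simp add: L0_def)
  have r: "0 < r" "r < 1" using q c by (auto simp: r_def powr_less_one)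
  define B where "B = {s \<in> S. L0 < f s}"
  have "\<exists>i. L0 * q ^ i < f s \<and> f s \<le> q * (L0 * q ^ i)" if s: "s \<in> B" for s
  proof -
    obtain j where "f s / L0 < q ^ j" using real_arch_pow[OF q] by blast
    then have ex: "\<exists>j. f s \<le> L0 * q ^ j" using L0 by (intro exI[of _ j]) (simp add: field_simps)
    \<comment> \<open>The least exponent is positive because \<open>f s > L0\<close>; its
      predecessor is the index of the class.\<close>
    define i where "i = (LEAST j. f s \<le> L0 * q ^ j)"
    have i: "f s \<le> L0 * q ^ i" unfolding i_def using ex by (rule LeastI_ex)
    have "i \<noteq> 0" using i s by (intro notI) (simp add: B_def)
    then obtain i' where i': "i = Suc i'" using not0_implies_Suc by blast
    have "\<not> f s \<le> L0 * q ^ i'" using not_less_Least[of i' "\<lambda>j. f s \<le> L0 * q ^ j"] i' by (simp add: i_def)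
    then show ?thesis using i i' by (intro exI[of _ i']) (simp add: mult_ac)
  qed
  then obtain ix where ix: "\<And>s. s \<in> B \<Longrightarrow> L0 * q ^ ix s < f s \<and> f s \<le> q * (L0 * q ^ ix s)" by metis
  have finB: "finite B" using fin by (simp add: B_def)
  obtain I where I: "\<And>s. s \<in> B \<Longrightarrow> ix s < I"
    using finite_nat_set_iff_bounded[of "ix ` B"] finB by auto
  have np: "real n powr (1 - 1 / c) = real n * real n powr (- 1 / c)"
    using S(2) by (simp add: powr_diff powr_minus divide_inverse)
  have class_sum: "(\<Sum>s\<in>{s \<in> B. ix s = i}. f s) \<le> q * K * W * real n powr (1 - 1 / c) * r ^ i" for i
  proof -
    define L where "L = L0 * q ^ i"
    have L: "0 < L" using L0 q by (simp add: L_def)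
    have "(\<Sum>s\<in>{s \<in> B. ix s = i}. f s) \<le> (\<Sum>s\<in>{s \<in> B. ix s = i}. q * L)"
      using ix by (intro sum_mono) (auto simp: L_def)
    also have "\<dots> = real (card {s \<in> B. ix s = i}) * (q * L)" by simp
    also have "\<dots> \<le> K * (W / L) powr c * (q * L)"
    proof (intro mult_right_mono)
      have "card {s \<in> B. ix s = i} \<le> card {s \<in> S. L < f s \<and> f s \<le> q * L}"
        using fin ix by (intro card_mono) (auto simp: L_def B_def)
      then show "real (card {s \<in> B. ix s = i}) \<le> K * (W / L) powr c" using cls[OF L] by linarith
    qed (use L q in auto)
    also have "\<dots> = q * K * (W powr c * L powr (1 - c))"
      using L pos by (simp add: powr_divide powr_diff field_simps)
    also have "W powr c * L powr (1 - c) = W * real n powr (1 - 1 / c) * r ^ i"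
    proof -
      have "L powr (1 - c) = W powr (1 - c) * real n powr ((- 1 / c) * (1 - c)) * (q ^ i) powr (1 - c)"
        using pos S(2) q by (simp add: L_def L0_def powr_mult powr_powr)
      also have "(- 1 / c) * (1 - c) = 1 - 1 / c" using c by (simp add: field_simps)
      also have "(q ^ i) powr (1 - c) = r ^ i"
        using q by (simp add: r_def powr_realpow[symmetric] powr_powr powr_power mult_ac)
      finally have "W powr c * L powr (1 - c) = (W powr c * W powr (1 - c)) * real n powr (1 - 1 / c) * r ^ i"
        by (simp add: mult_ac)
      also have "W powr c * W powr (1 - c) = W" using pos by (simp flip: powr_add)
      finally show ?thesis .
    qed
    finally show ?thesis by (simp add: mult_ac)
  qed
  have "sum f B = (\<Sum>i<I. \<Sum>s\<in>{s \<in> B. ix s = i}. f s)"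
    using I finB by (intro sum.group[symmetric]) auto
  also have "\<dots> \<le> (\<Sum>i<I. q * K * W * real n powr (1 - 1 / c) * r ^ i)"
    by (intro sum_mono class_sum)
  also have "\<dots> = q * K * W * real n powr (1 - 1 / c) * (\<Sum>i<I. r ^ i)"
    by (simp add: sum_distrib_left)
  also have "\<dots> \<le> q * K * W * real n powr (1 - 1 / c) * (1 / (1 - r))"
  proof (intro mult_left_mono)
    have "(\<Sum>i<I. r ^ i) = (1 - r ^ I) / (1 - r)" using r by (simp add: sum_gp_strict)
    also have "\<dots> \<le> 1 / (1 - r)" using r by (intro divide_right_mono) auto
    finally show "(\<Sum>i<I. r ^ i) \<le> 1 / (1 - r)" .
  qed (use q pos in auto)
  finally have big: "sum f B \<le> q * K / (1 - r) * real n powr (1 - 1 / c) * W" by (simp add: mult_ac)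
  have "sum f (S - B) \<le> (\<Sum>s\<in>S - B. L0)" by (intro sum_mono) (auto simp: B_def)
  also have "\<dots> = real (card (S - B)) * L0" by simp
  also have "\<dots> \<le> real n * L0"
    using S(1) L0 card_mono[OF fin Diff_subset, of B] by (intro mult_right_mono) auto
  also have "\<dots> = real n powr (1 - 1 / c) * W" by (simp add: L0_def np)
  finally have small: "sum f (S - B) \<le> real n powr (1 - 1 / c) * W" .
  have "sum f S = sum f (S - B) + sum f B"
    using fin by (intro sum.subset_diff) (auto simp: B_def)
  then show ?thesis using big small by (simp add: r_def algebra_simps)
qed

section \<open>Assembling the bound\<close>

lemma finite_tours: "finite {T. is_tour n T}"
proof (rule finite_subset)
  show "{T. is_tour n T} \<subseteq> Pow (Pow {..<n})"
  proof (rule subsetI, rule PowI, rule subsetI)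
    fix T x assume "T \<in> {T. is_tour n T}" "x \<in> T"
    then obtain vs where vs: "set vs = {..<n}" "x \<in># cyc_edges vs" by (auto simp: is_tour_iff)
    then obtain a b where "x = {a, b}" "(a, b) \<in># cyc_pairs vs" by (auto simp: cyc_edges_def)
    then show "x \<in> Pow {..<n}" using cyc_pairs_mem_set[of a b vs] vs(1) by simp
  qed
qed simp

lemma OPT_attained:
  assumes "is_tour n T"
  obtains T' where "is_tour n T'" "OPT n w = tour_cost w T'"
proof -
  have "{tour_cost w T | T. is_tour n T} = tour_cost w ` {T. is_tour n T}" by blast
  then have "OPT n w \<in> tour_cost w ` {T. is_tour n T}"
    unfolding OPT_def using finite_tours[of n] assms by (metis Min_in empty_iff finite_imageI imageI mem_Collect_eq)
  then show ?thesis using that by blast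
qed

theorem theorem4p18:
  fixes k :: nat and c d :: real
  assumes "3 \<le> k" and "c > 1" and "d > 0"
    and "\<forall>x::nat. 0 < x \<longrightarrow> real (ex x (2 * k)) \<le> d * real x powr c"
  shows "\<exists>C::real. \<forall>n w T. metric_instance n w \<longrightarrow> OPT n w > 0 \<longrightarrow> k_optimal k n w T \<longrightarrow>
           tour_cost w T \<le> C * real n powr (1 - 1 / c) * OPT n w"
proof -
  \<comment> \<open>With this value \<open>3 * k * eps = 3 / 2\<close>, within the limit 2 of
    \<open>no_improving_closed_walk\<close>.\<close>
  define eps where "eps = 1 / (2 * real k)"
  \<comment> \<open>The factor 4 comes from the cut, \<open>d\<close> from the bound on
    \<open>ex\<close>, and \<open>2 / eps\<close> from the number of clusters, which is at most
    \<open>(2 / eps) * (OPT n w / L)\<close> for a nonempty class.\<close>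
  define K where "K = 4 * d * (2 / eps) powr c"
  define q where "q = 1 + eps"
  have eps: "0 < eps" "eps \<le> 1" "3 * real k * eps \<le> 2"
    using assms(1) by (auto simp: eps_def field_simps)
  show ?thesis
  proof (intro exI[of _ "1 + q * K / (1 - q powr (1 - c))"] allI impI)
    fix n w T assume metric: "metric_instance n w" and W: "OPT n w > 0" and opt: "k_optimal k n w T"
    obtain vs where n: "3 \<le> n" and vs: "distinct vs" "set vs = {..<n}" and T: "T = set_mset (cyc_edges vs)"
      using opt unfolding k_optimal_def is_tour_iff by blast
    have len: "length vs = n" using vs by (metis card_lessThan distinct_card)
    obtain S where S: "is_tour n S" "OPT n w = tour_cost w S"
      using OPT_attained opt unfolding k_optimal_def by metis
    define f where "f e = w (edge_of e)" for e :: "nat \<times> nat"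
    have "sum f (set_mset (cyc_pairs vs)) \<le> (1 + q * K / (1 - q powr (1 - c))) * real n powr (1 - 1 / c) * OPT n w"
    proof (rule sum_geometric_classes)
      show "card (set_mset (cyc_pairs vs)) \<le> n"
        using card_length[of "zip vs (rotate1 vs)"] len by (simp add: cyc_pairs_def)
      show "0 \<le> K" using assms(3) by (simp add: K_def)
      fix L :: real assume L: "0 < L"
      let ?E = "{e \<in> set_mset (cyc_pairs vs). L < f e \<and> f e \<le> q * L}"
      show "real (card ?E) \<le> K * (OPT n w / L) powr c"
      proof (cases "?E = {}")
        case True
        then show ?thesis using assms(3) by (simp only: card.empty) (simp add: K_def)
      next
        case False
        have \<delta>: "0 < eps * L" using eps L by simp
        obtain seg m where seg: "\<And>x. x < n \<Longrightarrow> seg x < m"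
          "0 < m" "real m \<le> tour_cost w S / (eps * L) + 1"
          "\<And>x y. x < n \<Longrightarrow> y < n \<Longrightarrow> x \<noteq> y \<Longrightarrow> seg x = seg y \<Longrightarrow> w {x, y} \<le> eps * L"
          "\<And>x y. x < n \<Longrightarrow> y < n \<Longrightarrow> x \<noteq> y \<Longrightarrow> w {x, y} \<le> tour_cost w S"
          using ex_clustering[OF metric S(1) \<delta>] by blast
        obtain e where e: "e \<in># cyc_pairs vs" "L < f e" using False by blast
        have "fst e < n" "snd e < n" "fst e \<noteq> snd e"
          using e(1) cyc_pairs_mem_set[of "fst e" "snd e" vs] vs(2)
            cyc_pairs_asym(2)[OF vs(1), of "fst e" "snd e"] n len by auto
        \<comment> \<open>An edge longer than \<open>L\<close> forces \<open>L\<close> below the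
          optimum. This lets a factor 2 absorb the summand 1 in the cluster count.\<close>
        then have "L \<le> OPT n w" using seg(5) e(2) S(2) by (fastforce simp: f_def)
        then have "eps * L \<le> 1 * OPT n w" using eps L by (intro mult_mono) auto
        then have "1 \<le> OPT n w / (eps * L)" using \<delta> by (simp add: field_simps)
        moreover have "2 / eps * (OPT n w / L) = 2 * (OPT n w / (eps * L))" by simp
        ultimately have m: "real m \<le> 2 / eps * (OPT n w / L)"
          using seg(3)[folded S(2)] by linarith
        have "card ?E \<le> 4 * ex m (2 * k)"
          unfolding f_def q_def
          by (rule card_length_class_le_ex[OF metric opt[unfolded T] vs n _ seg(4,1)])
            (use L eps assms(1) in auto)
        then have "real (card ?E) \<le> 4 * real (ex m (2 * k))" by linarith
        also have "\<dots> \<le> 4 * (d * real m powr c)" using assms(4) seg(2) by simp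
        also have "\<dots> \<le> 4 * (d * (2 / eps * (OPT n w / L)) powr c)"
          using m assms(2,3) by (intro mult_left_mono powr_mono2) auto
        also have "\<dots> = K * (OPT n w / L) powr c"
          by (simp only: K_def mult.assoc powr_mult)
        finally show ?thesis .
      qed
    qed (use n W eps assms(2) in \<open>auto simp: q_def\<close>)
    moreover have "tour_cost w T = sum f (set_mset (cyc_pairs vs))"
    proof -
      have "cyc_pairs vs = mset_set (set_mset (cyc_pairs vs))"
        using vs(1) by (simp add: cyc_pairs_def mset_set_set distinct_zipI1)
      moreover have "tour_cost w T = (\<Sum>e\<in>#cyc_pairs vs. f e)"
        using tour_cost_cyc_edges[OF vs(1)] n len
        by (simp add: T cyc_edges_def f_def multiset.map_comp comp_def case_prod_unfold)
      ultimately show ?thesis by (simp add: sum_unfold_sum_mset)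
    qed
    ultimately show "tour_cost w T \<le> (1 + q * K / (1 - q powr (1 - c))) * real n powr (1 - 1 / c) * OPT n w"
      by simp
  qed
qed

end
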